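(* Let $L$ be a finite-dimensional restricted Lie algebra over an algebraically closed field of characteristic $p>0$. The following conditions are equivalent: (i) $L$ is upper semimodular; (ii) $L$ is modular; (iii) every restricted subalgebra of $L$ is a restricted quasi-ideal of $L$. Moreover, if one of these conditions holds, then $L$ is either almost abelian or nilpotent of class at most $2$.
   Context: All algebras are finite-dimensional. For a subset $S$ (or several subsets) of a restricted Lie algebra $L$ with $p$-map $x\mapsto x^{[p]}$, $\langle S\rangle_p$ denotes the restricted subalgebra generated by $S$. "Maximal" means maximal among proper restricted subalgebras. A restricted subalgebra $S$ of $L$ is upper semimodular in $L$ if $S$ is maximal in $\langle S,T\rangle_p$ for every restricted subalgebra $T$ of $L$ such that $S\cap T$ is maximal in $T$. $L$ is upper semimodular if all of its restricted subalgebras are upper semimodular in $L$. $L$ is modular if its lattice of restricted subalgebras is modular: $\langle X,Y\rangle_p\cap Z=\langle X,Y\cap Z\rangle_p$ for all restricted subalgebras $X,Y,Z$ of $L$ with $X\subseteq Z$. A restricted subalgebra $S$ of $L$ is a restricted quasi-ideal of $L$ if $[S,H]\subseteq S+H$ for all restricted subalgebras $H$ of $L$. A Lie algebra $L$ over $\mathbb{F}$ is almost abelian if $L=\mathbb{F}x\dot{+}A$ (vector space direct sum), where $A$ is an abelian ideal of $L$ and $\mathrm{ad}(x)$ acts as the identity map on $A$. *)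

theory Defs
  imports "HOL-Computational_Algebra.Computational_Algebra"
begin

text \<open>The carrier of an algebra is the whole type \<open>'v\<close>, with scalars in the field \<open>'k\<close>.\<close>

locale lie_algebra = vector_space scale
  for scale :: "'k::field \<Rightarrow> 'v::ab_group_add \<Rightarrow> 'v" +
  fixes bracket :: "'v \<Rightarrow> 'v \<Rightarrow> 'v"
  assumes bracket_add_left: "bracket (x + y) z = bracket x z + bracket y z"
    and bracket_add_right: "bracket x (y + z) = bracket x y + bracket x z"
    and bracket_scale_left: "bracket (scale a x) y = scale a (bracket x y)"
    and bracket_scale_right: "bracket x (scale a y) = scale a (bracket x y)"
    and bracket_self: "bracket x x = 0"
    and jacobi: "bracket x (bracket y z) + bracket y (bracket z x) + bracket z (bracket x y) = 0"
begin

definition bracket_span :: "'v set \<Rightarrow> 'v set \<Rightarrow> 'v set" where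
  "bracket_span S T = span {bracket s t | s t. s \<in> S \<and> t \<in> T}"

definition lie_ideal :: "'v set \<Rightarrow> bool" where
  "lie_ideal A \<longleftrightarrow> subspace A \<and> (\<forall>y. \<forall>a\<in>A. bracket y a \<in> A)"

definition almost_abelian :: bool where
  "almost_abelian \<longleftrightarrow>
    (\<exists>x A. lie_ideal A \<and> (\<forall>a\<in>A. \<forall>b\<in>A. bracket a b = 0) \<and>
      span {x} \<inter> A = {0} \<and> {u + a | u a. u \<in> span {x} \<and> a \<in> A} = UNIV \<and>
      (\<forall>a\<in>A. bracket x a = a))"

text \<open>Indexing starts at \<open>0\<close>: the value at \<open>n\<close> is the term usually written with index \<open>n + 1\<close>,
  so that nilpotency of class at most \<open>c\<close> is the vanishing of the value at \<open>c\<close>.\<close>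

primrec lower_central :: "nat \<Rightarrow> 'v set" where
  "lower_central 0 = UNIV"
| "lower_central (Suc n) = bracket_span UNIV (lower_central n)"

definition nilpotent_class_le :: "nat \<Rightarrow> bool" where
  "nilpotent_class_le c \<longleftrightarrow> lower_central c = {0}"

text \<open>The operator \<open>ad(t x + y)\<close> on the Lie algebra of polynomials in \<open>t\<close> with coefficients
  in \<open>'v\<close>; \<open>pCons 0\<close> is multiplication by \<open>t\<close>.\<close>

definition ad_poly :: "'v \<Rightarrow> 'v \<Rightarrow> 'v poly \<Rightarrow> 'v poly" where
  "ad_poly x y q = pCons 0 (map_poly (bracket x) q) + map_poly (bracket y) q"

text \<open>Jacobson's terms \<open>s\<^sub>i(x, y)\<close>: \<open>i s\<^sub>i(x, y)\<close> is the coefficient of \<open>t\<close> to the power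
  \<open>i - 1\<close> in \<open>ad(t x + y)\<close> to the power \<open>p - 1\<close> applied to \<open>x\<close>, where \<open>p\<close> is the characteristic.\<close>

definition jacobson_term :: "nat \<Rightarrow> 'v \<Rightarrow> 'v \<Rightarrow> 'v" where
  "jacobson_term i x y =
    scale (inverse (of_nat i))
      (poly.coeff ((ad_poly x y ^^ (CHAR('k) - 1)) [:x:]) (i - 1))"

end

locale restricted_lie_algebra = lie_algebra scale bracket
  for scale :: "'k::field \<Rightarrow> 'v::ab_group_add \<Rightarrow> 'v"
    and bracket :: "'v \<Rightarrow> 'v \<Rightarrow> 'v" +
  fixes pmap :: "'v \<Rightarrow> 'v"
  assumes char_pos: "CHAR('k) > 0"
    and pmap_scale: "pmap (scale a x) = scale (a ^ CHAR('k)) (pmap x)"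
    and ad_pmap: "bracket (pmap x) y = (bracket x ^^ CHAR('k)) y"
    and pmap_add: "pmap (x + y) = pmap x + pmap y + (\<Sum>i = 1..CHAR('k) - 1. jacobson_term i x y)"
begin

definition restricted_subalgebra :: "'v set \<Rightarrow> bool" where
  "restricted_subalgebra S \<longleftrightarrow>
    subspace S \<and> (\<forall>x\<in>S. \<forall>y\<in>S. bracket x y \<in> S) \<and> (\<forall>x\<in>S. pmap x \<in> S)"

definition generated :: "'v set \<Rightarrow> 'v set" where
  "generated S = restricted_subalgebra hull S"

definition maximal_in :: "'v set \<Rightarrow> 'v set \<Rightarrow> bool" where
  "maximal_in M T \<longleftrightarrow> restricted_subalgebra M \<and> M \<subset> T \<and>
    \<not> (\<exists>N. restricted_subalgebra N \<and> M \<subset> N \<and> N \<subset> T)"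

definition upper_semimodular_in :: "'v set \<Rightarrow> bool" where
  "upper_semimodular_in S \<longleftrightarrow>
    (\<forall>T. restricted_subalgebra T \<and> maximal_in (S \<inter> T) T \<longrightarrow> maximal_in S (generated (S \<union> T)))"

definition upper_semimodular :: bool where
  "upper_semimodular \<longleftrightarrow> (\<forall>S. restricted_subalgebra S \<longrightarrow> upper_semimodular_in S)"

definition modular :: bool where
  "modular \<longleftrightarrow>
    (\<forall>X Y Z. restricted_subalgebra X \<and> restricted_subalgebra Y \<and> restricted_subalgebra Z \<and> X \<subseteq> Z
      \<longrightarrow> generated (X \<union> Y) \<inter> Z = generated (X \<union> (Y \<inter> Z)))"

definition restricted_quasi_ideal :: "'v set \<Rightarrow> bool" where
  "restricted_quasi_ideal S \<longleftrightarrow> restricted_subalgebra S \<and>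
    (\<forall>H. restricted_subalgebra H \<longrightarrow> bracket_span S H \<subseteq> {s + h | s h. s \<in> S \<and> h \<in> H})"

end

end

(*
  Over an algebraically closed field every nonzero restricted subalgebra contains a restricted line
  (an "atom"). If the lattice is upper semimodular, the join of two atoms has height two, and an
  eigenvector argument shows that it is their linear span. If two atoms do not commute, they span
  [t, y] = y with t toral; the weight spaces of t other than the line of t and weight one are
  excluded by exhibiting pairs of atoms whose span is not closed, so the algebra is almost abelian.
  If all atoms commute, toral elements are central, and by the Fitting decomposition of the p-map
  all adjoint maps are nilpotent. Engel's theorem then makes every cover in the lattice of
  codimension one, so semimodularity gives that joins are sums, i.e. condition (iii). Finally (iii)
  with nilpotency gives [x, y] in the sum of the subalgebras generated by the p-th powers of x and
  y, and a descending induction shows that p-th powers are central.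
*)

theory Submission
  imports Defs
begin

section \<open>Linear and semilinear maps over an algebraically closed field\<close>

text \<open>The p-map is in general not additive; Jacobson's formula guarantees additivity only on
  commuting elements. Eigenvector arguments for it are therefore run inside a single cyclic
  subalgebra, which is abelian. They first give eigenvectors modulo a subspace, and the errors are
  removed by solving \<open>c^p - \<epsilon> c = \<mu>\<close>, which uses the algebraic closure. A
  toral t satisfies t^[p] = t, so ad t is a root of X^p - X and has no nilpotent Jordan blocks; this
  stands in for diagonalization. Given [t, y] = y, little else fits: brackets add weights, while the
  bracket of two atoms must lie in their span and so can only carry the weights already present. The
  final induction descends because nilpotency makes a high p-power central at once. Each step bounds
  the order of ad u on x by three, which suffices when p is at least 3. In characteristic 2 the
  p-power of u acts as the square of ad u, and a specially scaled element is needed instead.\<close>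

context finite_dimensional_vector_space
begin

lemma span_insert_sequence:
  fixes e :: "nat \<Rightarrow> 'b"
  assumes "subspace W"
  shows "x \<in> span (W \<union> e ` {..<n}) \<longleftrightarrow>
    (\<exists>a. \<exists>w\<in>W. x = (\<Sum>i<n. scale (a i) (e i)) + w)"
proof (induction n arbitrary: x)
  case 0
  from assms have "span W = W" by simp
  then show ?case by (simp del: span_eq_iff)
next
  case (Suc n)
  have "W \<union> e ` {..<Suc n} = insert (e n) (W \<union> e ` {..<n})"
    by (auto simp: lessThan_Suc)
  then have "x \<in> span (W \<union> e ` {..<Suc n}) \<longleftrightarrow>
      (\<exists>k a. \<exists>w\<in>W. x - scale k (e n) = (\<Sum>i<n. scale (a i) (e i)) + w)"
    by (simp add: span_breakdown_eq Suc)
  also have "\<dots> \<longleftrightarrow> (\<exists>a. \<exists>w\<in>W. x = (\<Sum>i<Suc n. scale (a i) (e i)) + w)" (is "?L \<longleftrightarrow> ?R")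
  proof
    assume ?L
    then obtain k a w where w: "w \<in> W" "x - scale k (e n) = (\<Sum>i<n. scale (a i) (e i)) + w"
      by blast
    have "(\<Sum>i<n. scale ((a(n := k)) i) (e i)) = (\<Sum>i<n. scale (a i) (e i))"
      by (intro sum.cong) auto
    with w have "x = (\<Sum>i<Suc n. scale ((a(n := k)) i) (e i)) + w"
      by (simp add: algebra_simps)
    with w(1) show ?R by blast
  next
    assume ?R
    then obtain a w where "w \<in> W" "x = (\<Sum>i<Suc n. scale (a i) (e i)) + w" by blast
    then have "x - scale (a n) (e n) = (\<Sum>i<n. scale (a i) (e i)) + w" by simp
    with \<open>w \<in> W\<close> show ?L by blast
  qed
  finally show ?case .
qed

text \<open>Plays the part of a minimal polynomial on the quotient by \<open>W\<close>, without
  forming the quotient. If no term depended on \<open>W\<close> and its predecessors, dimensions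
  would grow forever; minimality of \<open>n\<close> makes the earlier terms independent modulo
  \<open>W\<close>. The sequence is arbitrary so that orbits of linear and of semilinear maps are
  both covered.\<close>

lemma first_dependence_mod:
  fixes e :: "nat \<Rightarrow> 'b"
  assumes W: "subspace W"
  obtains n a w where "w \<in> W" "e n = (\<Sum>i<n. scale (a i) (e i)) + w"
    "\<forall>b. (\<Sum>i<n. scale (b i) (e i)) \<in> W \<longrightarrow> (\<forall>i<n. b i = 0)"
proof -
  define U where "U n = W \<union> e ` {..<n}" for n
  have "\<exists>n. e n \<in> span (U n)"
  proof (rule ccontr)
    assume "\<not> ?thesis"
    then have new: "e n \<notin> span (U n)" for n by blast
    have "n \<le> dim (U n)" for n
    proof (induction n)
      case (Suc n)
      have "span (U n) \<subseteq> span (U (Suc n))"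
        by (intro span_mono) (auto simp: U_def)
      moreover have "e n \<in> span (U (Suc n))"
        by (intro span_base) (auto simp: U_def)
      ultimately have "dim (U n) < dim (U (Suc n))"
        using new[of n] by (intro dim_psubset) blast
      with Suc show ?case by simp
    qed simp
    from this[of "Suc dimension"] dim_subset_UNIV[of "U (Suc dimension)"] show False by simp
  qed
  then obtain n where n: "e n \<in> span (U n)" and least: "\<And>m. m < n \<Longrightarrow> e m \<notin> span (U m)"
    using exists_least_iff[of "\<lambda>n. e n \<in> span (U n)"] by blast
  from n obtain a w where aw: "w \<in> W" "e n = (\<Sum>i<n. scale (a i) (e i)) + w"
    unfolding U_def span_insert_sequence[OF W] by blast
  have indep: "\<forall>i<m. b i = 0" if "(\<Sum>i<m. scale (b i) (e i)) \<in> W" "m \<le> n" for b m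
    using that
  proof (induction m)
    case (Suc m)
    have "b m = 0"
    proof (rule ccontr)
      assume nz: "b m \<noteq> 0"
      define w' where "w' = (\<Sum>i<Suc m. scale (b i) (e i))"
      have "scale (b m) (e m) = w' - (\<Sum>i<m. scale (b i) (e i))"
        by (simp add: w'_def)
      then have "scale (inverse (b m)) (scale (b m) (e m)) = scale (inverse (b m)) (w' - (\<Sum>i<m. scale (b i) (e i)))"
        by (rule arg_cong)
      then have "e m = scale (inverse (b m)) (w' - (\<Sum>i<m. scale (b i) (e i)))"
        using nz by simp
      also have "\<dots> = (\<Sum>i<m. scale (- inverse (b m) * b i) (e i)) + scale (inverse (b m)) w'"
        by (simp add: scale_right_diff_distrib scale_sum_right sum_negf)
      finally have "e m = \<dots>" .
      moreover have "scale (inverse (b m)) w' \<in> W"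
        using W Suc.prems(1) w'_def subspace_scale by blast
      ultimately have "e m \<in> span (U m)"
        unfolding U_def span_insert_sequence[OF W]
        by (intro exI[of _ "\<lambda>i. - inverse (b m) * b i"] bexI[of _ "scale (inverse (b m)) w'"])
      with least[of m] Suc.prems(2) show False by simp
    qed
    with Suc show ?case by (auto simp: less_Suc_eq)
  qed simp
  show thesis using aw indep by (intro that[of w n a]) auto
qed

end

locale alg_closed_vector_space = finite_dimensional_vector_space scale Basis
  for scale :: "'k::alg_closed_field \<Rightarrow> 'v::ab_group_add \<Rightarrow> 'v" and Basis

text \<open>The first relation among the iterates of \<open>x\<close> modulo \<open>W\<close> is a
  polynomial P. A root \<open>c\<close> gives P = (X - c) R, and v = R(f) x works: (f - c) v = P(f)
  x lies in \<open>W\<close>, while v does not, since R has smaller degree and the earlier iterates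
  are independent modulo \<open>W\<close>.\<close>

lemma (in alg_closed_vector_space) eigenvector_mod:
  fixes f :: "'v \<Rightarrow> 'v"
  assumes add: "\<And>x y. f (x + y) = f x + f y"
    and scale: "\<And>c x. f (scale c x) = scale c (f x)"
    and V: "subspace V" "\<And>x. x \<in> V \<Longrightarrow> f x \<in> V"
    and W: "subspace W" and x: "x \<in> V" "x \<notin> W"
  obtains v c where "v \<in> V" "v \<notin> W" "f v - scale c v \<in> W"
proof -
  define e where "e i = (f ^^ i) x" for i
  have eV: "e i \<in> V" for i by (induction i) (auto simp: e_def x V)
  obtain w n a where aw: "w \<in> W" "e n = (\<Sum>i<n. scale (a i) (e i)) + w"
    and indep: "\<forall>b. (\<Sum>i<n. scale (b i) (e i)) \<in> W \<longrightarrow> (\<forall>i<n. b i = 0)"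
    by (rule first_dependence_mod[OF W, of e])
  have "n \<noteq> 0" using aw x by (auto simp: e_def intro!: Nat.gr0I)
  then obtain m where m: "n = Suc m" by (cases n) auto
  define P where "P = monom 1 n - (\<Sum>i<n. monom (a i) i)"
  have coeffP: "coeff P i = (if i = n then 1 else if i < n then - a i else 0)" for i
    by (auto simp: P_def coeff_sum)
  have degP: "degree P = n"
    by (rule antisym[OF degree_le le_degree]) (auto simp: coeffP)
  then obtain c where "poly P c = 0" using alg_closed_imp_poly_has_root[of P] m by auto
  then obtain R where R: "P = [:-c, 1:] * R" by (auto simp: poly_eq_0_iff_dvd)
  have "P \<noteq> 0" using degP m by auto
  with R have "R \<noteq> 0" by auto
  then have degR: "degree R = m"
    using degree_mult_eq[of "[:-c, 1:]" R] degP m unfolding R by simp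
  define v where "v = (\<Sum>i<n. scale (coeff R i) (e i))"
  have f0: "f 0 = 0" using add[of 0 0] by simp
  have fsum: "f (\<Sum>i<k. scale (b i) (e i)) = (\<Sum>i<k. scale (b i) (e (Suc i)))" for b k
    by (induction k) (simp_all add: add scale f0 e_def)
  have coeffR: "coeff P i = (if i = 0 then 0 else coeff R (i - 1)) - c * coeff R i" for i
    by (cases i) (auto simp: R coeff_pCons)
  have "(\<Sum>i<Suc n. scale (coeff P i) (e i)) =
      (\<Sum>i<Suc n. scale (if i = 0 then 0 else coeff R (i - 1)) (e i)) - scale c (\<Sum>i<Suc n. scale (coeff R i) (e i))"
    by (simp only: coeffR scale_left_diff_distrib sum_subtractf scale_sum_right scale_scale)
  also have "(\<Sum>i<Suc n. scale (if i = 0 then 0 else coeff R (i - 1)) (e i)) = f v"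
    by (subst sum.lessThan_Suc_shift) (simp add: v_def fsum)
  also have "(\<Sum>i<Suc n. scale (coeff R i) (e i)) = v"
    using degR m by (simp add: v_def coeff_eq_0)
  finally have "f v - scale c v = (\<Sum>i<Suc n. scale (coeff P i) (e i))" by simp
  also have "\<dots> = w"
  proof -
    have "(\<Sum>i<n. scale (coeff P i) (e i)) = (\<Sum>i<n. - scale (a i) (e i))"
      by (intro sum.cong) (auto simp: coeffP)
    then show ?thesis using aw by (simp add: coeffP sum_negf)
  qed
  finally have "f v - scale c v \<in> W" using aw by simp
  moreover have "v \<notin> W"
  proof
    assume "v \<in> W"
    then have "coeff R m = 0" using indep[rule_format, of "coeff R" m] m by (simp add: v_def)
    with degR \<open>R \<noteq> 0\<close> show False by auto
  qed
  moreover have "v \<in> V"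
    unfolding v_def by (intro subspace_sum V(1) subspace_scale eV)
  ultimately show thesis by (intro that)
qed

text \<open>These are the coefficient equations of a vector fixed by a semilinear map. Writing b_i =
  c s_i(c) makes everything polynomial in the one unknown \<open>c\<close>, and b_m = c becomes
  s_m(c) = 1. Since \<open>a 0\<close> is nonzero, no s_i is constant, so a root exists; since s_m
  vanishes at 0, the root is nonzero.\<close>

lemma frobenius_recurrence_solvable:
  fixes a :: "nat \<Rightarrow> 'k :: alg_closed_field"
  assumes "p \<ge> 2" "a 0 \<noteq> 0"
  obtains c b where "c \<noteq> 0" "b 0 = c ^ p * a 0"
    "\<And>i. b (Suc i) = b i ^ p + c ^ p * a (Suc i)" "b m = c"
proof -
  obtain r where p: "p = Suc (Suc r)" using assms(1) by (metis add_2_eq_Suc le_Suc_ex)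
  define s where "s = rec_nat (monom (a 0) (p - 1))
    (\<lambda>i q. monom 1 (p - 1) * q ^ p + monom (a (Suc i)) (p - 1))"
  have s0: "s 0 = monom (a 0) (p - 1)"
    and sS: "\<And>i. s (Suc i) = monom 1 (p - 1) * s i ^ p + monom (a (Suc i)) (p - 1)"
    by (simp_all add: s_def)
  have deg: "degree (s i) > 0" for i
  proof (induction i)
    case 0
    then show ?case using assms p by (simp add: s0 degree_monom_eq)
  next
    case (Suc i)
    then have nz: "s i \<noteq> 0" by auto
    have "degree (monom 1 (p - 1) * s i ^ p) = (p - 1) + p * degree (s i)"
      using nz by (simp add: degree_mult_eq degree_monom_eq degree_power_eq)
    moreover have "p * degree (s i) > 0" "p > 0" using Suc p by simp_all
    ultimately have lt: "degree (monom 1 (p - 1) * s i ^ p) > p - 1" by linarith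
    have "degree (monom (a (Suc i)) (p - 1)) \<le> p - 1" by (rule degree_monom_le)
    then have "degree (s (Suc i)) = degree (monom 1 (p - 1) * s i ^ p)"
      unfolding sS using lt by (intro degree_add_eq_left) simp
    with lt show ?case by simp
  qed
  have "degree (s m - 1) = degree (s m)"
    using degree_add_eq_left[of "-1" "s m"] deg[of m] by simp
  with deg[of m] obtain c where c: "poly (s m - 1) c = 0"
    using alg_closed_imp_poly_has_root[of "s m - 1"] by auto
  have "poly (s m) 0 = 0"
    by (cases m) (simp_all add: s0 sS poly_monom p)
  with c have "c \<noteq> 0" by auto
  define b where "b i = c * poly (s i) c" for i
  show thesis
  proof (rule that[of c b])
    show "b 0 = c ^ p * a 0" by (simp add: b_def s0 poly_monom p)
    show "b (Suc i) = b i ^ p + c ^ p * a (Suc i)" for i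
      by (simp add: b_def sS poly_monom p power_mult_distrib algebra_simps)
    show "b m = c" using c by (simp add: b_def)
  qed fact
qed

text \<open>The two uses are p-th roots (\<open>\<epsilon> = 0\<close>) and Artin-Schreier equations
  (\<open>\<epsilon> = 1\<close>), matching the two eigenvalues of a semilinear map.\<close>

lemma artin_schreier_solvable:
  fixes \<epsilon> \<mu> :: "'k :: alg_closed_field"
  assumes "p \<ge> 2"
  obtains c where "c ^ p - \<epsilon> * c = \<mu>"
proof -
  have "coeff (monom 1 p - [:\<mu>, \<epsilon>:]) p = 1"
    using assms by (auto simp: coeff_pCons split: nat.splits)
  then have "p \<le> degree (monom 1 p - [:\<mu>, \<epsilon>:])"
    by (intro le_degree) simp
  then obtain c where "poly (monom 1 p - [:\<mu>, \<epsilon>:]) c = 0"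
    using alg_closed_imp_poly_has_root[of "monom 1 p - [:\<mu>, \<epsilon>:]"] assms by auto
  then show thesis by (intro that[of c]) (simp add: poly_monom algebra_simps)
qed

text \<open>The model is the p-map on an abelian restricted subalgebra \<open>D\<close>; outside
  such a \<open>D\<close> additivity cannot be expected.\<close>

locale semilinear_map = alg_closed_vector_space scale Basis
  for scale :: "'k::alg_closed_field \<Rightarrow> 'v::ab_group_add \<Rightarrow> 'v" and Basis +
  fixes \<phi> :: "'v \<Rightarrow> 'v" and D :: "'v set"
  assumes char_prime: "prime CHAR('k)"
    and subspace_D: "subspace D"
    and map_D: "x \<in> D \<Longrightarrow> \<phi> x \<in> D"
    and map_add: "x \<in> D \<Longrightarrow> y \<in> D \<Longrightarrow> \<phi> (x + y) = \<phi> x + \<phi> y"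
    and map_scale: "\<phi> (scale c x) = scale (c ^ CHAR('k)) (\<phi> x)"
begin

lemma map_zero: "\<phi> 0 = 0"
  using map_add[OF subspace_0[OF subspace_D] subspace_0[OF subspace_D]] by simp

lemma char_ge_2: "CHAR('k) \<ge> 2"
  using char_prime prime_ge_2_nat by blast

lemma map_minus: "\<phi> (- x) = - \<phi> x"
  using map_scale[of "-1" x] by (simp add: minus_power_prime_CHAR[OF refl char_prime])

lemma map_diff: "x \<in> D \<Longrightarrow> y \<in> D \<Longrightarrow> \<phi> (x - y) = \<phi> x - \<phi> y"
  using map_add[of x "- y"] subspace_neg[OF subspace_D, of y] by (simp add: map_minus)

lemma map_sum:
  fixes e :: "nat \<Rightarrow> 'v"
  assumes "\<And>i. e i \<in> D"
  shows "\<phi> (\<Sum>i<n. scale (b i) (e i)) = (\<Sum>i<n. scale (b i ^ CHAR('k)) (\<phi> (e i)))"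
proof (induction n)
  case (Suc n)
  have "(\<Sum>i<n. scale (b i) (e i)) \<in> D" "scale (b n) (e n) \<in> D"
    using assms subspace_D by (auto intro!: subspace_sum subspace_scale)
  with Suc show ?case by (simp add: map_add map_scale)
qed (simp add: map_zero)

lemma power_root: obtains c where "c ^ CHAR('k) = (a :: 'k)"
  using artin_schreier_solvable[OF char_ge_2, of 0 a] by auto

text \<open>Eigenvalues can be normalized to 0 or 1, because rescaling a vector by d multiplies its
  eigenvalue by d^(p-1). Which of the two occurs is decided by the constant term of the first
  relation among the iterates.\<close>

lemma semilinear_eigenvector_mod:
  assumes C: "subspace C" and x: "x \<in> D" "x \<notin> C" and C_map: "\<And>y. y \<in> C \<Longrightarrow> \<phi> y \<in> C"
  obtains v \<epsilon> where "v \<in> D" "v \<notin> C" "\<epsilon> = 0 \<or> \<epsilon> = 1" "\<phi> v - scale \<epsilon> v \<in> C"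
proof -
  define e where "e i = (\<phi> ^^ i) x" for i
  have eD: "e i \<in> D" for i by (induction i) (auto simp: e_def x map_D)
  have phi_e: "\<phi> (e i) = e (Suc i)" for i by (simp add: e_def)
  obtain w n a where aw: "w \<in> C" "e n = (\<Sum>i<n. scale (a i) (e i)) + w"
    and indep: "\<forall>b. (\<Sum>i<n. scale (b i) (e i)) \<in> C \<longrightarrow> (\<forall>i<n. b i = 0)"
    by (rule first_dependence_mod[OF C, of e])
  have "n \<noteq> 0" using aw x by (auto simp: e_def intro!: Nat.gr0I)
  then obtain m where m: "n = Suc m" by (cases n) auto
  show thesis
  proof (cases "a 0 = 0")
    case True
    \<comment> \<open>Without constant term the relation is the image under \<open>\<phi>\<close> of
      a shorter combination, found by taking p-th roots; the coefficient -1, which is its own p-th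
      power, keeps that combination outside \<open>C\<close>.\<close>
    define b where "b i = (if i = m then -1 else SOME c. c ^ CHAR('k) = a (Suc i))" for i
    have b: "b i ^ CHAR('k) = a (Suc i)" if "i < m" for i
      using that someI_ex[of "\<lambda>c. c ^ CHAR('k) = a (Suc i)"] power_root[of "a (Suc i)"]
      by (auto simp: b_def)
    have bm: "b m ^ CHAR('k) = -1"
      by (simp add: b_def minus_power_prime_CHAR[OF refl char_prime])
    define v where "v = (\<Sum>i<n. scale (b i) (e i))"
    have "\<phi> v = (\<Sum>i<m. scale (a (Suc i)) (e (Suc i))) - e n"
      unfolding v_def map_sum[OF eD] by (simp add: m bm b phi_e)
    also have "\<dots> = - w"
      using aw(2) unfolding m sum.lessThan_Suc_shift by (simp add: True)
    finally have "\<phi> v = - w" .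
    then have "\<phi> v - scale 0 v \<in> C" using aw(1) subspace_neg[OF C] by simp
    moreover have "v \<notin> C"
    proof
      assume "v \<in> C"
      then have "b m = 0" using indep[rule_format, of b m] m by (simp add: v_def)
      then show False by (simp add: b_def)
    qed
    moreover have "v \<in> D"
      unfolding v_def by (intro subspace_sum subspace_D subspace_scale eD)
    ultimately show thesis by (intro that[of v 0]) auto
  next
    case False
    \<comment> \<open>Comparing coefficients in \<open>\<phi> v = v\<close> modulo \<open>C\<close>,
      with \<open>e n\<close> replaced by means of the relation, gives exactly this
      recurrence.\<close>
    obtain c b where c: "c \<noteq> 0" "b 0 = c ^ CHAR('k) * a 0"
      "\<And>i. b (Suc i) = b i ^ CHAR('k) + c ^ CHAR('k) * a (Suc i)" "b m = c"
      using frobenius_recurrence_solvable[OF char_ge_2, of a m] False by blast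
    define v where "v = (\<Sum>i<n. scale (b i) (e i))"
    have "\<phi> v = (\<Sum>i<m. scale (b i ^ CHAR('k)) (e (Suc i))) + scale (c ^ CHAR('k)) (e n)"
      unfolding v_def map_sum[OF eD] by (simp add: m c phi_e)
    also have "\<dots> = v + scale (c ^ CHAR('k)) w"
      using aw(2) unfolding v_def m sum.lessThan_Suc_shift
      by (simp add: c algebra_simps sum.distrib scale_sum_right)
    finally have "\<phi> v - scale 1 v \<in> C" using aw(1) subspace_scale[OF C] by simp
    moreover have "v \<notin> C"
    proof
      assume "v \<in> C"
      then have "b m = 0" using indep[rule_format, of b m] m by (simp add: v_def)
      then show False using c by simp
    qed
    moreover have "v \<in> D"
      unfolding v_def by (intro subspace_sum subspace_D subspace_scale eD)
    ultimately show thesis by (intro that[of v 1]) auto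
  qed
qed

section \<open>Fitting decomposition of a semilinear map\<close>

definition fixed_span :: "'v set" where
  "fixed_span = span {t \<in> D. \<phi> t = t}"

text \<open>When \<open>\<phi>\<close> is the p-map, this consists of the p-nilpotent elements of
  \<open>D\<close> and \<open>fixed_span\<close> is spanned by the toral ones.\<close>

definition nil_part :: "'v set" where
  "nil_part = {x \<in> D. \<exists>k. (\<phi> ^^ k) x = 0}"

lemma funpow_D: "x \<in> D \<Longrightarrow> (\<phi> ^^ k) x \<in> D"
  by (induction k) (auto simp: map_D)

lemma funpow_add: "x \<in> D \<Longrightarrow> y \<in> D \<Longrightarrow> (\<phi> ^^ k) (x + y) = (\<phi> ^^ k) x + (\<phi> ^^ k) y"
  by (induction k) (auto simp: map_add funpow_D)

lemma funpow_zero: "(\<phi> ^^ k) 0 = 0"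
  by (induction k) (auto simp: map_zero)

lemma fixed_span_subset: "fixed_span \<subseteq> D"
  unfolding fixed_span_def by (intro span_minimal subspace_D) auto

text \<open>On multiples d x of a fixed vector, \<open>\<phi> - \<epsilon>\<close> sends the
  coefficient d to \<open>d^p - \<epsilon> d\<close>, and this is onto the field.\<close>

lemma fixed_span_surj:
  assumes "t \<in> fixed_span"
  shows "\<phi> t \<in> fixed_span" "\<exists>s\<in>fixed_span. \<phi> s - scale \<epsilon> s = t"
proof -
  have "\<phi> t \<in> fixed_span \<and> (\<exists>s\<in>fixed_span. \<phi> s - scale \<epsilon> s = t)"
    using assms unfolding fixed_span_def
  proof (induction rule: span_induct_alt)
    case base
    show ?case by (auto simp: map_zero span_zero intro!: bexI[of _ 0])
  next
    case (step c x y)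
    then obtain s where s: "s \<in> span {t \<in> D. \<phi> t = t}" "\<phi> s - scale \<epsilon> s = y" by blast
    obtain d where d: "d ^ CHAR('k) - \<epsilon> * d = c" by (rule artin_schreier_solvable[OF char_ge_2])
    have x: "x \<in> D" "\<phi> x = x" "x \<in> span {t \<in> D. \<phi> t = t}" using step by (auto intro: span_base)
    have sub: "span {t \<in> D. \<phi> t = t} \<subseteq> D" using fixed_span_subset by (simp add: fixed_span_def)
    have D: "scale d x \<in> D" "s \<in> D"
      using x s(1) sub subspace_scale[OF subspace_D] by blast+
    have "\<phi> (scale d x + s) - scale \<epsilon> (scale d x + s) = scale (d ^ CHAR('k) - \<epsilon> * d) x + (\<phi> s - scale \<epsilon> s)"
      using D x by (simp add: map_add map_scale algebra_simps)
    then have 1: "\<phi> (scale d x + s) - scale \<epsilon> (scale d x + s) = scale c x + y"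
      using d s by simp
    have 2: "scale d x + s \<in> span {t \<in> D. \<phi> t = t}"
      using x s by (intro span_add span_scale)
    have yD: "y \<in> D"
      using D s(2) map_D subspace_D by (metis subspace_diff subspace_scale)
    have "\<phi> (scale c x + y) = scale (c ^ CHAR('k)) x + \<phi> y"
      using x yD subspace_scale[OF subspace_D] by (simp add: map_add map_scale)
    then have "\<phi> (scale c x + y) \<in> span {t \<in> D. \<phi> t = t}"
      using step x by (simp add: span_add span_scale)
    with 1 2 show ?case by blast
  qed
  then show "\<phi> t \<in> fixed_span" "\<exists>s\<in>fixed_span. \<phi> s - scale \<epsilon> s = t" by blast+
qed

lemma nil_part_preimage: "x \<in> D \<Longrightarrow> \<phi> x \<in> nil_part \<Longrightarrow> x \<in> nil_part"
  unfolding nil_part_def by (auto simp: funpow_swap1 intro: exI[of _ "Suc k" for k])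

lemma nil_part_map: "x \<in> nil_part \<Longrightarrow> \<phi> x \<in> nil_part"
  unfolding nil_part_def using map_D map_zero by (auto simp flip: funpow_swap1) metis

lemma subspace_nil_part: "subspace nil_part"
proof (rule subspaceI)
  show "0 \<in> nil_part" using subspace_0[OF subspace_D] by (auto simp: nil_part_def intro!: exI[of _ 0])
next
  fix x y assume "x \<in> nil_part" "y \<in> nil_part"
  then obtain k l where xy: "x \<in> D" "y \<in> D" "(\<phi> ^^ k) x = 0" "(\<phi> ^^ l) y = 0"
    by (auto simp: nil_part_def)
  have "(\<phi> ^^ (l + k)) x = 0" "(\<phi> ^^ (k + l)) y = 0"
    using xy by (simp_all add: funpow_add funpow_zero Nat.funpow_add)
  then have "(\<phi> ^^ (k + l)) (x + y) = 0"
    using xy by (simp add: funpow_add add.commute)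
  then show "x + y \<in> nil_part"
    using xy subspace_add[OF subspace_D] by (auto simp: nil_part_def)
next
  fix c x assume "x \<in> nil_part"
  then obtain k where x: "x \<in> D" "(\<phi> ^^ k) x = 0"
    by (auto simp: nil_part_def)
  have "\<exists>d. (\<phi> ^^ k) (scale c x) = scale d ((\<phi> ^^ k) x)"
    by (induction k) (auto simp: map_scale)
  with x have "(\<phi> ^^ k) (scale c x) = 0" by auto
  then show "scale c x \<in> nil_part"
    using x subspace_scale[OF subspace_D] by (auto simp: nil_part_def)
qed

text \<open>Fitting decomposition: a vector that is fixed modulo nilpotent vectors becomes fixed after
  adding the sum of its forward orbit differences.\<close>

lemma fixed_plus_nil:
  assumes "x \<in> D"
  obtains t n where "t \<in> fixed_span" "n \<in> nil_part" "x = t + n"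
proof -
  define C where "C = {t + n | t n. t \<in> fixed_span \<and> n \<in> nil_part}"
  have sub_fixed: "subspace fixed_span" by (simp add: fixed_span_def)
  have subC: "subspace C"
    unfolding C_def by (intro subspace_sums sub_fixed subspace_nil_part)
  have nilD: "nil_part \<subseteq> D" by (auto simp: nil_part_def)
  have C_map: "\<phi> y \<in> C" if "y \<in> C" for y
  proof -
    from that obtain t n where tn: "t \<in> fixed_span" "n \<in> nil_part" "y = t + n"
      unfolding C_def by blast
    then have "\<phi> y = \<phi> t + \<phi> n"
      using fixed_span_subset nilD by (auto intro!: map_add)
    with tn show ?thesis unfolding C_def using fixed_span_surj(1) nil_part_map by blast
  qed
  have fixed_C: "t \<in> C" if "t \<in> fixed_span" for t
    using that subspace_0[OF subspace_nil_part] unfolding C_def by force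
  have nil_C: "n \<in> C" if "n \<in> nil_part" for n
    using that subspace_0[OF sub_fixed] unfolding C_def by force
  have "x \<in> C"
  proof (rule ccontr)
    assume "x \<notin> C"
    then obtain v \<epsilon> where v: "v \<in> D" "v \<notin> C" "\<epsilon> = 0 \<or> \<epsilon> = 1" "\<phi> v - scale \<epsilon> v \<in> C"
      using semilinear_eigenvector_mod[OF subC assms _ C_map] by blast
    then obtain t n where tn: "t \<in> fixed_span" "n \<in> nil_part" "\<phi> v - scale \<epsilon> v = t + n"
      unfolding C_def by blast
    \<comment> \<open>Subtracting \<open>s\<close> from \<open>v\<close> absorbs the fixed part of
      the error, leaving an eigenvector up to a nilpotent error.\<close>
    obtain s where s: "s \<in> fixed_span" "\<phi> s - scale \<epsilon> s = t"
      using fixed_span_surj(2)[OF tn(1)] by blast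
    have sD: "s \<in> D" using s fixed_span_subset by blast
    define u where "u = v - s"
    have uD: "u \<in> D" unfolding u_def using v sD subspace_diff[OF subspace_D] by blast
    have "\<phi> u = \<phi> v - \<phi> s" unfolding u_def using v sD by (intro map_diff) auto
    then have phiu: "\<phi> u = scale \<epsilon> u + n"
      using tn(3) s(2) by (simp add: u_def algebra_simps)
    have uC: "u \<notin> C"
    proof
      assume "u \<in> C"
      then have "u + s \<in> C" using fixed_C[OF s(1)] subspace_add[OF subC] by blast
      with v show False by (simp add: u_def)
    qed
    from v(3) show False
    proof
      assume "\<epsilon> = 0"
      then have "\<phi> u \<in> nil_part" using phiu tn by simp
      then show False using nil_part_preimage[OF uD] nil_C uC by blast
    next
      assume "\<epsilon> = 1"
      then have phiu: "\<phi> u = u + n" using phiu by simp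
      obtain k where k: "(\<phi> ^^ k) n = 0" using tn by (auto simp: nil_part_def)
      have orbit: "(\<phi> ^^ j) u - u \<in> nil_part" for j
      proof (induction j)
        case (Suc j)
        have "\<phi> ((\<phi> ^^ j) u - u) \<in> nil_part" using Suc by (rule nil_part_map)
        then have "\<phi> ((\<phi> ^^ j) u) - \<phi> u \<in> nil_part"
          using map_diff[OF funpow_D[OF uD] uD] by simp
        then have "\<phi> ((\<phi> ^^ j) u) - \<phi> u + n \<in> nil_part"
          using tn(2) subspace_add[OF subspace_nil_part] by blast
        then show ?case by (simp add: phiu)
      qed (simp add: subspace_0[OF subspace_nil_part])
      \<comment> \<open>After \<open>k\<close> steps the error is dead, so the iterate is exactly
        fixed, and by \<open>orbit\<close> it differs from \<open>u\<close> by a nilpotent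
        vector.\<close>
      have "(\<phi> ^^ k) (\<phi> u) = (\<phi> ^^ k) u"
        using tn(2) nilD uD k unfolding phiu by (subst funpow_add) auto
      then have "\<phi> ((\<phi> ^^ k) u) = (\<phi> ^^ k) u" by (simp add: funpow_swap1)
      then have "(\<phi> ^^ k) u \<in> fixed_span"
        using funpow_D[OF uD] by (auto simp: fixed_span_def intro!: span_base)
      then have "(\<phi> ^^ k) u - ((\<phi> ^^ k) u - u) \<in> C"
        using fixed_C nil_C[OF orbit] subspace_diff[OF subC] by blast
      with uC show False by simp
    qed
  qed
  then show thesis unfolding C_def using that by blast
qed

text \<open>High iterates kill the nilpotent component. For the p-map, this reduces questions about
  ad x, up to a p-power, to toral elements.\<close>

lemma funpow_in_fixed_span:
  assumes "x \<in> D"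
  obtains k where "(\<phi> ^^ k) x \<in> fixed_span"
proof -
  obtain t n where tn: "t \<in> fixed_span" "n \<in> nil_part" "x = t + n"
    using fixed_plus_nil[OF assms] by blast
  then obtain k where k: "(\<phi> ^^ k) n = 0" "n \<in> D" by (auto simp: nil_part_def)
  have "(\<phi> ^^ j) t \<in> fixed_span" for j
    by (induction j) (auto simp: tn fixed_span_surj(1))
  moreover have "(\<phi> ^^ k) x = (\<phi> ^^ k) t"
    using tn k fixed_span_subset by (auto simp: funpow_add)
  ultimately show thesis by (intro that[of k]) simp
qed

end

section \<open>Restricted subalgebras\<close>

context lie_algebra
begin

lemma bracket_zero [simp]: "bracket 0 x = 0" "bracket x 0 = 0"
  using bracket_add_left[of 0 0 x] bracket_add_right[of x 0 0] by simp_all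

lemma bracket_minus: "bracket (- x) y = - bracket x y" "bracket x (- y) = - bracket x y"
  using bracket_add_left[of x "- x" y] bracket_add_right[of x y "- y"]
  by (simp_all add: add_eq_0_iff)

lemma bracket_diff: "bracket (x - y) z = bracket x z - bracket y z"
  "bracket x (y - z) = bracket x y - bracket x z"
  using bracket_add_left[of x "- y" z] bracket_add_right[of x y "- z"] by (simp_all add: bracket_minus)

lemmas bracket_linear = bracket_add_left bracket_add_right bracket_scale_left bracket_scale_right
  bracket_minus bracket_diff bracket_self

lemma bracket_swap: "bracket x y = - bracket y x"
proof -
  have "bracket (x + y) (x + y) = 0" by (rule bracket_self)
  then have "bracket x y + bracket y x = 0"
    unfolding bracket_add_left bracket_add_right by (simp add: bracket_self add.commute)
  then show ?thesis by (simp add: add_eq_0_iff2)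
qed

lemma bracket_derivation: "bracket x (bracket y z) = bracket (bracket x y) z + bracket y (bracket x z)"
  using jacobi[of x y z] bracket_swap[of "bracket x y" z] bracket_swap[of x z]
  by (simp add: bracket_minus add_eq_0_iff2 algebra_simps neg_eq_iff_add_eq_0)

lemma bracket_bracket: "bracket (bracket x y) z = bracket x (bracket y z) - bracket y (bracket x z)"
  using bracket_derivation[of x y z] by simp

lemma funpow_bracket_zero [simp]: "(bracket x ^^ n) 0 = 0"
  by (induction n) auto

lemma funpow_bracket_eigenvector:
  assumes "bracket x y = scale c y"
  shows "(bracket x ^^ n) y = scale (c ^ n) y"
  by (induction n) (auto simp: bracket_scale_right assms mult.commute)

lemma funpow_bracket_mem:
  assumes "\<And>z. z \<in> K \<Longrightarrow> bracket x z \<in> K" "y \<in> K"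
  shows "(bracket x ^^ n) y \<in> K"
  by (induction n) (auto simp: assms)

lemma funpow_bracket_eq_0:
  assumes "(bracket x ^^ m) y = 0" "m \<le> n"
  shows "(bracket x ^^ n) y = 0"
  using assms funpow_add[of "n - m" m "bracket x"] by simp

lemma subspace_centralizer: "subspace {y. bracket x y = 0}"
  by (rule subspaceI) (auto simp: bracket_linear)

definition sum_set :: "'v set \<Rightarrow> 'v set \<Rightarrow> 'v set" where
  "sum_set S T = {s + t | s t. s \<in> S \<and> t \<in> T}"

lemma sum_setI: "s \<in> S \<Longrightarrow> t \<in> T \<Longrightarrow> s + t \<in> sum_set S T"
  by (auto simp: sum_set_def)

lemma subspace_sum_set: "subspace S \<Longrightarrow> subspace T \<Longrightarrow> subspace (sum_set S T)"
  unfolding sum_set_def by (rule subspace_sums)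

lemma sum_set_upper:
  assumes "subspace S" "subspace T"
  shows "S \<subseteq> sum_set S T" "T \<subseteq> sum_set S T"
  using sum_setI[of _ S 0 T] sum_setI[of 0 S _ T] assms[THEN subspace_0] by auto

lemma sum_set_least: "subspace U \<Longrightarrow> S \<subseteq> U \<Longrightarrow> T \<subseteq> U \<Longrightarrow> sum_set S T \<subseteq> U"
  by (auto simp: sum_set_def intro: subspace_add)

lemma bracket_span_subset_iff:
  "subspace U \<Longrightarrow> bracket_span S T \<subseteq> U \<longleftrightarrow> (\<forall>s\<in>S. \<forall>t\<in>T. bracket s t \<in> U)"
  unfolding bracket_span_def using span_superset[of "{bracket s t |s t. s \<in> S \<and> t \<in> T}"]
  by (subst subset_hull[of subspace, folded span_def]) auto

lemma span_pair: "x \<in> span {a, b} \<longleftrightarrow> (\<exists>\<alpha> \<beta>. x = scale \<alpha> a + scale \<beta> b)"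
proof -
  have "x \<in> span {a, b} \<longleftrightarrow> (\<exists>\<alpha> \<beta>. x - scale \<alpha> a = scale \<beta> b)"
    by (auto simp: span_breakdown_eq)
  then show ?thesis by (metis add_diff_cancel_left' diff_add_cancel add.commute)
qed

lemma span_singleton_mem: "x \<in> span {a} \<longleftrightarrow> (\<exists>c. x = scale c a)"
  by (auto simp: span_singleton)

lemma coeff_ad_poly:
  "coeff (ad_poly x y q) i = (case i of 0 \<Rightarrow> 0 | Suc j \<Rightarrow> bracket x (coeff q j)) + bracket y (coeff q i)"
  by (auto simp: ad_poly_def coeff_map_poly coeff_pCons split: nat.splits)

end

context restricted_lie_algebra
begin

lemma char_prime: "prime CHAR('k)"
  using char_pos by (intro prime_CHAR_semidom)

lemma char_ge_2: "CHAR('k) \<ge> 2"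
  using char_prime prime_ge_2_nat by blast

lemma char_Suc_Suc: obtains r where "CHAR('k) = Suc (Suc r)"
  using char_ge_2 by (metis add_2_eq_Suc le_Suc_ex)

text \<open>The hypothesis concerns the bracket of \<open>y\<close> with \<open>x\<close> and not \<open>x\<close> itself because
  \<open>p - 1 \<ge> 1\<close> brackets are applied to \<open>x\<close>, of which the first with \<open>x\<close> vanishes.\<close>

lemma jacobson_term_mem:
  assumes K: "subspace K" "bracket y x \<in> K"
    and x: "\<And>z. z \<in> K \<Longrightarrow> bracket x z \<in> K" and y: "\<And>z. z \<in> K \<Longrightarrow> bracket y z \<in> K"
  shows "jacobson_term i x y \<in> K"
proof -
  obtain r where p: "CHAR('k) = Suc (Suc r)" by (rule char_Suc_Suc)
  have "coeff ((ad_poly x y ^^ Suc n) [:x:]) j \<in> K" for n j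
  proof (induction n arbitrary: j)
    case 0
    then show ?case
      using K subspace_0[OF K(1)]
      by (auto simp: coeff_ad_poly coeff_pCons bracket_self split: nat.splits)
  next
    case (Suc n)
    then have "coeff (ad_poly x y ((ad_poly x y ^^ Suc n) [:x:])) j \<in> K"
      unfolding coeff_ad_poly using K(1)
      by (auto simp del: funpow.simps intro!: subspace_add x y subspace_0 split: nat.splits)
    then show ?case by simp
  qed
  from this[of r] show ?thesis
    unfolding jacobson_term_def p by (intro subspace_scale K(1)) simp
qed

text \<open>Lets Jacobson's correction be treated as an unspecified member of a stable subspace; its
  terms are computed explicitly only in characteristic 2.\<close>

lemma pmap_add_mem:
  assumes K: "subspace K" "bracket y x \<in> K"
    and x: "\<And>z. z \<in> K \<Longrightarrow> bracket x z \<in> K" and y: "\<And>z. z \<in> K \<Longrightarrow> bracket y z \<in> K"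
  obtains k where "k \<in> K" "pmap (x + y) = pmap x + pmap y + k"
proof (rule that)
  show "(\<Sum>i = 1..CHAR('k) - 1. jacobson_term i x y) \<in> K"
    by (intro subspace_sum K(1) jacobson_term_mem[OF assms])
qed (rule pmap_add)

lemma pmap_add_commuting:
  assumes "bracket x y = 0"
  shows "pmap (x + y) = pmap x + pmap y"
proof -
  have "bracket y x \<in> {0}" using assms bracket_swap[of y x] by simp
  then obtain k where "k \<in> {0}" "pmap (x + y) = pmap x + pmap y + k"
    by (rule pmap_add_mem[of "{0}", rotated]) auto
  then show ?thesis by simp
qed

lemma pmap_zero [simp]: "pmap 0 = 0"
  using pmap_scale[of 0 0] char_pos by (simp add: power_0_left)

lemma bracket_pmap_commuting: "bracket x y = 0 \<Longrightarrow> bracket (pmap x) y = 0"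
  using funpow_bracket_eq_0[where m = 1 and n = "CHAR('k)"] char_ge_2 by (simp add: ad_pmap)

lemma restricted_subalgebra_inter: "\<forall>S\<in>\<A>. restricted_subalgebra S \<Longrightarrow> restricted_subalgebra (\<Inter>\<A>)"
  unfolding restricted_subalgebra_def by (auto intro!: subspace_Inter)

lemma restricted_subalgebra_Int:
  "restricted_subalgebra S \<Longrightarrow> restricted_subalgebra T \<Longrightarrow> restricted_subalgebra (S \<inter> T)"
  using restricted_subalgebra_inter[of "{S, T}"] by simp

lemma restricted_subalgebra_generated [intro]: "restricted_subalgebra (generated S)"
  unfolding generated_def by (rule hull_in) (rule restricted_subalgebra_inter)

lemma generated_superset: "S \<subseteq> generated S"
  unfolding generated_def by (rule hull_subset)

lemma generated_least: "S \<subseteq> R \<Longrightarrow> restricted_subalgebra R \<Longrightarrow> generated S \<subseteq> R"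
  unfolding generated_def by (rule hull_minimal)

lemma restricted_subalgebraD:
  assumes "restricted_subalgebra S"
  shows "subspace S" "x \<in> S \<Longrightarrow> y \<in> S \<Longrightarrow> bracket x y \<in> S" "x \<in> S \<Longrightarrow> pmap x \<in> S"
    "0 \<in> S" "x \<in> S \<Longrightarrow> y \<in> S \<Longrightarrow> x + y \<in> S" "x \<in> S \<Longrightarrow> scale c x \<in> S"
    "x \<in> S \<Longrightarrow> y \<in> S \<Longrightarrow> x - y \<in> S" "x \<in> S \<Longrightarrow> - x \<in> S"
  using assms unfolding restricted_subalgebra_def
  by (auto intro: subspace_0 subspace_add subspace_scale subspace_diff subspace_neg)

lemma restricted_subalgebra_zero: "restricted_subalgebra {0}"
  by (auto simp: restricted_subalgebra_def)

text \<open>Closure under brackets is enough: the p-map of s + t differs from the sum of the p-maps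
  by iterated brackets.\<close>

lemma restricted_subalgebra_sum:
  assumes S: "restricted_subalgebra S" and T: "restricted_subalgebra T"
    and ST: "\<And>s t. s \<in> S \<Longrightarrow> t \<in> T \<Longrightarrow> bracket s t \<in> sum_set S T"
  shows "restricted_subalgebra (sum_set S T)"
proof -
  let ?K = "sum_set S T"
  have K: "subspace ?K"
    using S T by (intro subspace_sum_set restricted_subalgebraD)
  have upper: "S \<subseteq> ?K" "T \<subseteq> ?K"
    using sum_set_upper[of S T] S T restricted_subalgebraD(1) by blast+
  have TS: "bracket t s \<in> ?K" if "s \<in> S" "t \<in> T" for s t
    using ST[OF that] bracket_swap[of t s] subspace_neg[OF K] by metis
  have br: "bracket x y \<in> ?K" if xy: "x \<in> ?K" "y \<in> ?K" for x y
  proof -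
    from xy obtain s t s' t' where st: "x = s + t" "y = s' + t'" "s \<in> S" "t \<in> T" "s' \<in> S" "t' \<in> T"
      by (auto simp: sum_set_def)
    have "bracket s s' \<in> ?K" "bracket t t' \<in> ?K"
      using st upper restricted_subalgebraD(2)[OF S] restricted_subalgebraD(2)[OF T] by blast+
    with ST[of s t'] TS[of s' t] st show ?thesis
      by (auto simp: bracket_add_left bracket_add_right intro!: subspace_add[OF K])
  qed
  have "pmap x \<in> ?K" if x: "x \<in> ?K" for x
  proof -
    from x obtain s t where st: "x = s + t" "s \<in> S" "t \<in> T"
      by (auto simp: sum_set_def)
    then have "s \<in> ?K" "t \<in> ?K" using upper by blast+
    then obtain k where k: "k \<in> ?K" "pmap x = pmap s + pmap t + k"
      using pmap_add_mem[OF K, of t s] br st by blast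
    have "pmap s + pmap t \<in> ?K"
      using st by (intro sum_setI restricted_subalgebraD[OF S] restricted_subalgebraD[OF T])
    with k show ?thesis by (simp add: subspace_add[OF K])
  qed
  with K br show ?thesis by (simp add: restricted_subalgebra_def)
qed

lemma generated_Un_sum:
  assumes S: "restricted_subalgebra S" and T: "restricted_subalgebra T"
    and ST: "\<And>s t. s \<in> S \<Longrightarrow> t \<in> T \<Longrightarrow> bracket s t \<in> sum_set S T"
  shows "generated (S \<union> T) = sum_set S T"
proof
  show "generated (S \<union> T) \<subseteq> sum_set S T"
    using restricted_subalgebra_sum[OF assms] sum_set_upper[of S T] S T restricted_subalgebraD(1)
    by (intro generated_least) auto
  show "sum_set S T \<subseteq> generated (S \<union> T)"
    using generated_superset[of "S \<union> T"]
    by (intro sum_set_least restricted_subalgebraD(1)) auto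
qed

section \<open>Centralizers and cyclic restricted subalgebras\<close>

definition centralizer :: "'v set \<Rightarrow> 'v set" where
  "centralizer S = {y. \<forall>s\<in>S. bracket y s = 0}"

lemma restricted_subalgebra_centralizer: "restricted_subalgebra (centralizer S)"
  unfolding restricted_subalgebra_def centralizer_def
  by (auto simp: bracket_linear bracket_bracket bracket_pmap_commuting intro!: subspaceI)

definition cyclic :: "'v \<Rightarrow> 'v set" where
  "cyclic x = generated {x}"

lemma cyclic_restricted: "restricted_subalgebra (cyclic x)"
  unfolding cyclic_def by (rule restricted_subalgebra_generated)

lemma cyclic_self: "x \<in> cyclic x"
  using generated_superset[of "{x}"] by (simp add: cyclic_def)

lemma cyclic_least: "x \<in> R \<Longrightarrow> restricted_subalgebra R \<Longrightarrow> cyclic x \<subseteq> R"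
  unfolding cyclic_def by (intro generated_least) auto

lemma cyclic_commute:
  assumes "bracket x y = 0" "z \<in> cyclic x"
  shows "bracket z y = 0"
  using cyclic_least[OF _ restricted_subalgebra_centralizer, of x "{y}"] assms
  by (auto simp: centralizer_def)

text \<open>Centralizers are restricted subalgebras, so commuting with \<open>x\<close> passes to
  all that \<open>x\<close> generates, in one argument and then in the other.\<close>

lemma cyclic_abelian:
  assumes "y \<in> cyclic x" "z \<in> cyclic x"
  shows "bracket y z = 0"
proof -
  have "bracket y x = 0" using cyclic_commute[OF bracket_self assms(1)] .
  then have "bracket x y = 0" using bracket_swap[of x y] by simp
  then have "bracket z y = 0" using assms(2) by (rule cyclic_commute)
  then show ?thesis using bracket_swap[of y z] by simp
qed

lemma cyclic_pmap_subset: "cyclic (pmap x) \<subseteq> cyclic x"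
  using cyclic_self cyclic_restricted by (intro cyclic_least restricted_subalgebraD(3))

text \<open>By commutativity the p-map sends c x + z to c^p x^[p] + z^[p], so the right side is
  already closed. Its use is to isolate the single scalar that an element of \<open>cyclic x\<close>
  has modulo p-powers.\<close>

lemma cyclic_decompose: "cyclic x = sum_set (span {x}) (cyclic (pmap x))"
proof
  let ?U = "sum_set (span {x}) (cyclic (pmap x))"
  have up: "x \<in> cyclic x" "cyclic (pmap x) \<subseteq> cyclic x"
    by (rule cyclic_self cyclic_pmap_subset)+
  show sub: "?U \<subseteq> cyclic x"
    using up restricted_subalgebraD(1)[OF cyclic_restricted, of x]
    by (intro sum_set_least span_minimal) auto
  have subU: "subspace ?U"
    using restricted_subalgebraD(1)[OF cyclic_restricted] by (intro subspace_sum_set) auto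
  have upper: "span {x} \<subseteq> ?U" "cyclic (pmap x) \<subseteq> ?U"
    using sum_set_upper[of "span {x}" "cyclic (pmap x)"]
      restricted_subalgebraD(1)[OF cyclic_restricted] by auto
  have "pmap y \<in> ?U" if "y \<in> ?U" for y
  proof -
    from that obtain c z where y: "y = scale c x + z" "z \<in> cyclic (pmap x)"
      by (auto simp: sum_set_def span_singleton)
    have "bracket (scale c x) z = 0"
      using up y(2) by (intro cyclic_abelian[of _ x]) (auto intro: restricted_subalgebraD[OF cyclic_restricted])
    then have "pmap y = scale (c ^ CHAR('k)) (pmap x) + pmap z"
      unfolding y by (simp add: pmap_add_commuting pmap_scale)
    also have "\<dots> \<in> cyclic (pmap x)"
      using y(2) cyclic_self cyclic_restricted[of "pmap x"] by (simp add: restricted_subalgebraD)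
    finally show ?thesis using upper by blast
  qed
  moreover have "bracket y z \<in> ?U" if "y \<in> ?U" "z \<in> ?U" for y z
    using cyclic_abelian[of y x z] subspace_0[OF subU] subsetD[OF sub] that by simp
  ultimately have "restricted_subalgebra ?U"
    using subU by (auto simp: restricted_subalgebra_def)
  then show "cyclic x \<subseteq> ?U"
    using upper span_base[of x "{x}"] by (intro cyclic_least) auto
qed

end

locale fd_restricted_lie_algebra =
  restricted_lie_algebra scale bracket pmap + alg_closed_vector_space scale Basis
  for scale :: "'k::alg_closed_field \<Rightarrow> 'v::ab_group_add \<Rightarrow> 'v" and bracket pmap Basis
begin

lemma semilinear_on:
  assumes "restricted_subalgebra D" "\<And>x y. x \<in> D \<Longrightarrow> y \<in> D \<Longrightarrow> bracket x y = 0"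
  shows "semilinear_map scale Basis pmap D"
  using assms by unfold_locales (auto simp: char_prime restricted_subalgebraD pmap_add_commuting pmap_scale)

lemma semilinear_cyclic: "semilinear_map scale Basis pmap (cyclic x)"
  by (intro semilinear_on cyclic_restricted cyclic_abelian)

lemma pmap_eigenvector_mod:
  assumes C: "restricted_subalgebra C" and x: "x \<notin> C"
  obtains v \<epsilon> where "v \<in> cyclic x" "v \<notin> C" "\<epsilon> = 0 \<or> \<epsilon> = 1" "pmap v - scale \<epsilon> v \<in> C"
proof -
  interpret semilinear_map scale Basis pmap "cyclic x" by (rule semilinear_cyclic)
  show thesis
    by (rule semilinear_eigenvector_mod[OF restricted_subalgebraD(1)[OF C] cyclic_self x
          restricted_subalgebraD(3)[OF C]]) (assumption | rule that)+
qed

lemma subspace_psubset_dim: "subspace S \<Longrightarrow> subspace T \<Longrightarrow> S \<subset> T \<Longrightarrow> dim S < dim T"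
  by (metis dim_psubset span_eq_iff)

section \<open>Relations between the lattice conditions\<close>

lemma quasi_ideals_iff:
  "(\<forall>S. restricted_subalgebra S \<longrightarrow> restricted_quasi_ideal S) \<longleftrightarrow>
    (\<forall>S T. restricted_subalgebra S \<longrightarrow> restricted_subalgebra T \<longrightarrow>
      (\<forall>s\<in>S. \<forall>t\<in>T. bracket s t \<in> sum_set S T))"
proof -
  have *: "bracket_span S T \<subseteq> sum_set S T \<longleftrightarrow> (\<forall>s\<in>S. \<forall>t\<in>T. bracket s t \<in> sum_set S T)"
    if "restricted_subalgebra S" "restricted_subalgebra T" for S T
    using bracket_span_subset_iff[OF subspace_sum_set] that[THEN restricted_subalgebraD(1)]
    by simp
  show ?thesis unfolding restricted_quasi_ideal_def sum_set_def[symmetric] by (auto simp: *)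
qed

text \<open>Meets and joins are then those of the lattice of subspaces, where Dedekind's law
  holds.\<close>

lemma modular_if_joins_are_sums:
  assumes "\<And>S T. restricted_subalgebra S \<Longrightarrow> restricted_subalgebra T \<Longrightarrow> generated (S \<union> T) = sum_set S T"
  shows "modular"
  unfolding modular_def
proof (intro allI impI, elim conjE)
  fix X Y Z assume XYZ: "restricted_subalgebra X" "restricted_subalgebra Y" "restricted_subalgebra Z" "X \<subseteq> Z"
  have "sum_set X Y \<inter> Z = sum_set X (Y \<inter> Z)"
  proof
    show "sum_set X Y \<inter> Z \<subseteq> sum_set X (Y \<inter> Z)"
    proof
      fix z assume z: "z \<in> sum_set X Y \<inter> Z"
      then obtain x y where xy: "z = x + y" "x \<in> X" "y \<in> Y" by (auto simp: sum_set_def)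
      then have "z - x \<in> Z" using z XYZ restricted_subalgebraD(7)[OF XYZ(3)] by blast
      with xy show "z \<in> sum_set X (Y \<inter> Z)" by (auto intro: sum_setI)
    qed
    show "sum_set X (Y \<inter> Z) \<subseteq> sum_set X Y \<inter> Z"
      using XYZ restricted_subalgebraD(5)[OF XYZ(3)] by (auto simp: sum_set_def)
  qed
  then show "generated (X \<union> Y) \<inter> Z = generated (X \<union> Y \<inter> Z)"
    using XYZ by (simp add: assms restricted_subalgebra_Int)
qed

lemma modular_imp_upper_semimodular:
  assumes "modular"
  shows "upper_semimodular"
  unfolding upper_semimodular_def upper_semimodular_in_def
proof (intro allI impI, elim conjE)
  fix S T assume S: "restricted_subalgebra S" and T: "restricted_subalgebra T"
    and max: "maximal_in (S \<inter> T) T"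
  have upper: "S \<subseteq> generated (S \<union> T)" "T \<subseteq> generated (S \<union> T)"
    using generated_superset[of "S \<union> T"] by auto
  have "\<not> T \<subseteq> S" using max by (auto simp: maximal_in_def)
  then have proper: "S \<subset> generated (S \<union> T)" using upper by blast
  have "False" if N: "restricted_subalgebra N" "S \<subset> N" "N \<subset> generated (S \<union> T)" for N
  proof -
    \<comment> \<open>Modularity recovers \<open>N\<close> from \<open>T \<inter> N\<close>, which
      lies between \<open>S \<inter> T\<close> and \<open>T\<close> and so can only be one of these
      two.\<close>
    have "generated (S \<union> T) \<inter> N = generated (S \<union> (T \<inter> N))"
      using assms N S T unfolding modular_def by blast
    then have gen: "N = generated (S \<union> (T \<inter> N))" using N by blast
    have "\<not> (S \<inter> T \<subset> T \<inter> N \<and> T \<inter> N \<subset> T)"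
      using max restricted_subalgebra_Int[OF T N(1)] unfolding maximal_in_def by blast
    then consider "T \<inter> N = S \<inter> T" | "T \<subseteq> N" using N(2) by blast
    then show False
    proof cases
      case 1
      then have "N \<subseteq> S" using generated_least[of "S \<union> (T \<inter> N)" S] S gen by blast
      with N show False by blast
    next
      case 2
      then have "generated (S \<union> T) \<subseteq> N" using N by (intro generated_least) auto
      with N show False by blast
    qed
  qed
  with S proper show "maximal_in S (generated (S \<union> T))" unfolding maximal_in_def by blast
qed

section \<open>One-dimensional restricted subalgebras\<close>

definition atom :: "'v \<Rightarrow> bool" where
  "atom x \<longleftrightarrow> x \<noteq> 0 \<and> pmap x \<in> span {x}"

lemma restricted_subalgebra_span:
  assumes "pmap x \<in> span {x}"
  shows "restricted_subalgebra (span {x})"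
proof -
  from assms obtain d where d: "pmap x = scale d x" by (auto simp: span_singleton)
  show ?thesis unfolding restricted_subalgebra_def
    by (auto simp: span_singleton_mem bracket_linear pmap_scale d intro: exI[of _ 0])
qed

lemma atom_restricted: "atom x \<Longrightarrow> restricted_subalgebra (span {x})"
  by (simp add: atom_def restricted_subalgebra_span)

lemma atom_exists:
  assumes "restricted_subalgebra R" "R \<noteq> {0}"
  obtains x where "x \<in> R" "atom x"
proof -
  obtain y where y: "y \<in> R" "y \<noteq> 0" using assms restricted_subalgebraD(4)[OF assms(1)] by blast
  obtain v \<epsilon> where v: "v \<in> cyclic y" "v \<notin> {0}" "\<epsilon> = 0 \<or> \<epsilon> = 1" "pmap v - scale \<epsilon> v \<in> {0}"
    using pmap_eigenvector_mod[OF restricted_subalgebra_zero, of y] y by blast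
  then have "atom v" by (auto simp: atom_def span_singleton_mem)
  moreover have "v \<in> R" using v cyclic_least[OF y(1) assms(1)] by blast
  ultimately show thesis by (rule that[rotated])
qed

lemma subspace_of_line:
  assumes "subspace N" "N \<subseteq> span {x}" "y \<in> N" "y \<noteq> 0"
  shows "N = span {x}" "span {y} = span {x}"
proof -
  obtain c where c: "y = scale c x" using assms by (auto simp: span_singleton)
  with assms have "x = scale (inverse c) y" by auto
  then have "x \<in> span {y}" by (auto simp: span_singleton)
  then have 1: "span {x} \<subseteq> span {y}" by (intro span_minimal) auto
  have 2: "span {y} \<subseteq> N" using assms by (intro span_minimal) auto
  show "N = span {x}" "span {y} = span {x}" using 1 2 assms(2) by blast+
qed

text \<open>Semimodularity enters the study of atoms through this instance: distinct lines meet in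
  zero, which is maximal in either.\<close>

lemma atom_maximal_in_join:
  assumes usm: "upper_semimodular" and a: "atom a" and b: "atom b" "b \<notin> span {a}"
  shows "maximal_in (span {a}) (generated (span {a} \<union> span {b}))"
proof -
  have int: "span {a} \<inter> span {b} = {0}"
  proof (rule ccontr)
    assume "\<not> ?thesis"
    then obtain y where y: "y \<in> span {a}" "y \<in> span {b}" "y \<noteq> 0" using span_zero by blast
    then have "span {a} \<inter> span {b} = span {b}"
      by (intro subspace_of_line(1)[of _ b y]) (auto intro: subspace_inter)
    then show False using b span_base[of b "{b}"] by blast
  qed
  have "maximal_in {0} (span {b})"
    unfolding maximal_in_def
  proof (intro conjI notI)
    show "{0} \<subset> span {b}" using b(1) span_base[of b "{b}"] by (auto simp: atom_def span_zero)
    assume "\<exists>N. restricted_subalgebra N \<and> {0} \<subset> N \<and> N \<subset> span {b}"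
    then obtain N y where N: "restricted_subalgebra N" "N \<subset> span {b}" "y \<in> N" "y \<noteq> 0"
      by blast
    then have "N = span {b}"
      by (intro subspace_of_line(1)[of _ b y] restricted_subalgebraD(1)) auto
    with N show False by blast
  qed (rule restricted_subalgebra_zero)
  then show ?thesis
    using usm int atom_restricted[OF a] atom_restricted[OF b(1)]
    unfolding upper_semimodular_def upper_semimodular_in_def by metis
qed

text \<open>The join of two lines has height two, so that its proper restricted subalgebras are lines;
  an eigenvector of the bracket with \<open>a\<close> modulo \<open>a\<close> then shows that its dimension is two.\<close>

lemma bracket_atoms:
  assumes usm: "upper_semimodular" and a: "atom a" and b: "atom b"
  shows "bracket a b \<in> span {a, b}"
    and "bracket a b \<noteq> 0 \<Longrightarrow> x \<in> span {a, b} \<Longrightarrow> pmap x \<in> span {x}"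
proof -
  have "bracket a b \<in> span {a, b} \<and> (bracket a b \<noteq> 0 \<longrightarrow> (\<forall>x\<in>span {a, b}. pmap x \<in> span {x}))"
  proof (cases "bracket a b = 0")
    case nz: False
    have "b \<notin> span {a}" using nz by (auto simp: span_singleton_mem bracket_linear)
    have "a \<notin> span {b}" using nz by (auto simp: span_singleton_mem bracket_linear)
    define J where "J = generated (span {a} \<union> span {b})"
    have J: "restricted_subalgebra J" unfolding J_def by (rule restricted_subalgebra_generated)
    have "span {a} \<union> span {b} \<subseteq> J" unfolding J_def by (rule generated_superset)
    then have abJ: "a \<in> J" "b \<in> J" using span_base[of a "{a}"] span_base[of b "{b}"] by auto
    then have spanJ: "span {a, b} \<subseteq> J" by (intro span_minimal restricted_subalgebraD(1)[OF J]) auto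
    have maxa: "maximal_in (span {a}) J"
      unfolding J_def using usm a b \<open>b \<notin> span {a}\<close> by (rule atom_maximal_in_join)
    \<comment> \<open>An atom \<open>c\<close> of \<open>R\<close> off the line of \<open>a\<close>
      generates \<open>J\<close> together with \<open>a\<close>, by maximality of \<open>a\<close>;
      exchanging the roles makes \<open>c\<close> maximal in \<open>J\<close> too. The zero
      subalgebra is covered by \<open>c = 0\<close>.\<close>
    have line: "\<exists>c. R = span {c}" if R: "restricted_subalgebra R" "R \<subset> J" for R
    proof (cases "R = {0}")
      case True
      then show ?thesis by (intro exI[of _ 0]) simp
    next
      case False
      then obtain c where c: "c \<in> R" "atom c" by (rule atom_exists[OF R(1)])
      have cR: "span {c} \<subseteq> R" using c restricted_subalgebraD(1)[OF R(1)] by (intro span_minimal) auto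
      have "maximal_in (span {c}) J"
      proof (cases "c \<in> span {a}")
        case True
        have "span {c} = span {a}"
          using True c(2) by (intro subspace_of_line(2)[of "span {a}"]) (auto simp: atom_def)
        with maxa show ?thesis by simp
      next
        case False
        have "a \<notin> span {c}"
        proof
          assume "a \<in> span {c}"
          then have "span {a} = span {c}"
            using a by (intro subspace_of_line(2)[of "span {c}"]) (auto simp: atom_def)
          with False show False using span_base[of c "{c}"] by auto
        qed
        have "generated (span {a} \<union> span {c}) \<subseteq> J"
          using abJ c R cR by (intro generated_least J Un_least span_minimal restricted_subalgebraD(1)[OF J]) auto
        moreover have "span {a} \<subset> generated (span {a} \<union> span {c})"
          using generated_superset[of "span {a} \<union> span {c}"] False span_base[of c "{c}"] by blast
        ultimately have "generated (span {a} \<union> span {c}) = J"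
          using maxa restricted_subalgebra_generated unfolding maximal_in_def by blast
        then show ?thesis
          using atom_maximal_in_join[OF usm c(2) a \<open>a \<notin> span {c}\<close>] by (simp add: Un_commute)
      qed
      then have "R = span {c}" using R cR unfolding maximal_in_def by blast
      then show ?thesis by blast
    qed
    \<comment> \<open>\<open>cyclic x\<close> is abelian whereas \<open>J\<close> is not, so it is a
      proper subalgebra and hence a line.\<close>
    have pm: "pmap x \<in> span {x}" if x: "x \<in> J" for x
    proof (cases "x = 0")
      case False
      have sub: "cyclic x \<subseteq> J" using x J by (rule cyclic_least)
      have "cyclic x \<noteq> J" using nz abJ cyclic_abelian by blast
      with sub obtain c where c: "cyclic x = span {c}" using line[OF cyclic_restricted, of x] by blast
      have "span {x} = span {c}"
        using c False cyclic_self[of x] by (intro subspace_of_line(2)[of "span {c}"]) auto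
      moreover have "pmap x \<in> cyclic x" by (intro restricted_subalgebraD(3) cyclic_restricted cyclic_self)
      ultimately show ?thesis using c by simp
    qed simp
    \<comment> \<open>The plane of \<open>a\<close> and \<open>v\<close> will be closed under
      brackets, and under the p-map because that preserves each line of \<open>J\<close>; maximality
      of \<open>a\<close> then makes it all of \<open>J\<close>.\<close>
    obtain v c where v: "v \<in> J" "v \<notin> span {a}" "bracket a v - scale c v \<in> span {a}"
      using eigenvector_mod[of "bracket a" J "span {a}" b] J abJ \<open>b \<notin> span {a}\<close>
      by (auto simp: bracket_linear restricted_subalgebraD)
    obtain d where d: "bracket a v = scale c v + scale d a"
      using v(3) by (auto simp: span_singleton_mem algebra_simps)
    let ?K = "sum_set (span {a}) (span {v})"
    have av: "scale \<alpha> a + scale \<beta> v \<in> ?K" for \<alpha> \<beta>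
      by (intro sum_setI) (auto simp: span_singleton)
    have "restricted_subalgebra ?K"
    proof (rule restricted_subalgebra_sum)
      fix s t assume "s \<in> span {a}" "t \<in> span {v}"
      then obtain \<alpha> \<beta> where "s = scale \<alpha> a" "t = scale \<beta> v" by (auto simp: span_singleton)
      then have "bracket s t = scale (\<alpha> * \<beta> * d) a + scale (\<alpha> * \<beta> * c) v"
        by (simp add: bracket_linear d algebra_simps)
      then show "bracket s t \<in> ?K" using av by simp
    qed (use pm v abJ in \<open>auto intro: restricted_subalgebra_span\<close>)
    moreover have "span {a} \<subset> ?K"
      using sum_set_upper[of "span {a}" "span {v}"] v(2) span_base[of v "{v}"] by auto
    moreover have "?K \<subseteq> J"
      using v abJ by (intro sum_set_least span_minimal restricted_subalgebraD(1)[OF J]) auto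
    ultimately have K: "?K = J" using maxa unfolding maximal_in_def by blast
    then obtain \<alpha> \<beta> where b_eq: "b = scale \<alpha> a + scale \<beta> v"
      using abJ by (auto simp: sum_set_def span_singleton)
    have "\<beta> \<noteq> 0" using b_eq \<open>b \<notin> span {a}\<close> by (auto simp: span_singleton)
    have "scale \<beta> v = b - scale \<alpha> a" using b_eq by simp
    then have "scale (inverse \<beta>) (scale \<beta> v) = scale (inverse \<beta>) (b - scale \<alpha> a)" by simp
    then have "v = scale (inverse \<beta>) (b - scale \<alpha> a)" using \<open>\<beta> \<noteq> 0\<close> by simp
    also have "\<dots> \<in> span {a, b}" by (intro span_scale span_diff span_base) auto
    finally have "v \<in> span {a, b}" .
    then have "J \<subseteq> span {a, b}"
      unfolding K[symmetric] by (intro sum_set_least span_minimal) (auto intro: span_base)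
    moreover have "bracket a b \<in> J" using abJ J by (intro restricted_subalgebraD(2))
    ultimately show ?thesis using spanJ pm by blast
  qed (auto simp: span_zero)
  then show "bracket a b \<in> span {a, b}"
    and "bracket a b \<noteq> 0 \<Longrightarrow> x \<in> span {a, b} \<Longrightarrow> pmap x \<in> span {x}" by blast+
qed

section \<open>Algebras with nilpotent adjoint maps\<close>

definition ad_nilpotent :: bool where
  "ad_nilpotent \<longleftrightarrow> (\<forall>x. \<exists>n. \<forall>y. (bracket x ^^ n) y = 0)"

lemma ad_nilpotent_eventually_mem:
  assumes "ad_nilpotent" "subspace H" "y \<notin> H"
  obtains j where "(bracket x ^^ j) y \<notin> H" "bracket x ((bracket x ^^ j) y) \<in> H"
proof -
  obtain n where "(bracket x ^^ n) y = 0" using assms(1) unfolding ad_nilpotent_def by blast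
  then have "\<exists>n. (bracket x ^^ n) y \<in> H" using subspace_0[OF assms(2)] by metis
  then obtain n where n: "(bracket x ^^ n) y \<in> H" "\<And>m. m < n \<Longrightarrow> (bracket x ^^ m) y \<notin> H"
    using exists_least_iff[of "\<lambda>n. (bracket x ^^ n) y \<in> H"] by blast
  then have "n \<noteq> 0" using assms(3) by (intro notI) simp
  then obtain j where "n = Suc j" by (cases n) auto
  with n show thesis by (intro that[of j]) auto
qed

text \<open>Engel's theorem for the action of \<open>H\<close> on \<open>N\<close> modulo
  \<open>H\<close>. A subalgebra \<open>K\<close> of \<open>H\<close> of greatest dimension that
  sends some vector of \<open>N\<close> outside \<open>H\<close> into \<open>H\<close> is shown to
  be \<open>H\<close>.\<close>

lemma engel:
  assumes nil: "ad_nilpotent" and H: "subspace H" "\<And>x y. x \<in> H \<Longrightarrow> y \<in> H \<Longrightarrow> bracket x y \<in> H"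
    and N: "subspace N" "H \<subset> N" "\<And>x y. x \<in> H \<Longrightarrow> y \<in> N \<Longrightarrow> bracket x y \<in> N"
  obtains x where "x \<in> N" "x \<notin> H" "\<And>h. h \<in> H \<Longrightarrow> bracket h x \<in> H"
proof -
  have "\<exists>x\<in>N - H. \<forall>h\<in>H. bracket h x \<in> H"
    using H N
  proof (induction "dim H" arbitrary: H N rule: less_induct)
    case less
    define P where "P K \<longleftrightarrow> subspace K \<and> K \<subseteq> H \<and> (\<forall>x\<in>K. \<forall>y\<in>K. bracket x y \<in> K) \<and>
      (\<exists>x\<in>N - H. \<forall>h\<in>K. bracket h x \<in> H)" for K
    have "P {0}" using less.prems subspace_0[OF less.prems(1)] by (auto simp: P_def)
    then have "\<exists>K. P K \<and> (\<forall>K'. P K' \<longrightarrow> dim K' \<le> dim K)"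
      by (rule ex_has_greatest_nat[where b = "Suc dimension"]) (simp add: dim_subset_UNIV less_Suc_eq_le)
    then obtain K where K: "P K" "\<And>K'. P K' \<Longrightarrow> dim K' \<le> dim K" by blast
    then obtain x where x: "x \<in> N" "x \<notin> H" "\<And>h. h \<in> K \<Longrightarrow> bracket h x \<in> H"
      unfolding P_def by blast
    show ?case
    proof (cases "K = H")
      case True
      with x show ?thesis by blast
    next
      case False
      then have KH: "K \<subset> H" using K unfolding P_def by blast
      have subK: "subspace K" and clK: "\<And>x y. x \<in> K \<Longrightarrow> y \<in> K \<Longrightarrow> bracket x y \<in> K"
        using K unfolding P_def by blast+
      have "dim K < dim H" using subK less.prems(1) KH by (rule subspace_psubset_dim)
      \<comment> \<open>The induction hypothesis is used for the pair \<open>K\<close> in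
        \<open>H\<close> and yields \<open>v\<close> normalizing \<open>K\<close>.\<close>
      then have "\<exists>v\<in>H - K. \<forall>h\<in>K. bracket h v \<in> K"
        using subK clK KH less.prems(1,2) by (intro less.hyps) auto
      then obtain v where v: "v \<in> H" "v \<notin> K" "\<And>h. h \<in> K \<Longrightarrow> bracket h v \<in> K" by blast
      obtain j where j: "(bracket v ^^ j) x \<notin> H" "bracket v ((bracket v ^^ j) x) \<in> H"
        using nil less.prems(1) x(2) by (rule ad_nilpotent_eventually_mem)
      \<comment> \<open>Vectors that \<open>K\<close> sends into \<open>H\<close> stay such under ad
        v, since \<open>v\<close> normalizes \<open>K\<close>. The last iterate outside
        \<open>H\<close> is then sent into \<open>H\<close> by \<open>v\<close> as well, so
        \<open>K\<close> could be enlarged.\<close>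
      have W: "(bracket v ^^ i) x \<in> N \<and> (\<forall>h\<in>K. bracket h ((bracket v ^^ i) x) \<in> H)" for i
      proof (induction i)
        case (Suc i)
        have "bracket h (bracket v ((bracket v ^^ i) x)) \<in> H" if "h \<in> K" for h
          unfolding bracket_derivation[of h v]
          using Suc that v less.prems by (intro subspace_add) auto
        with Suc v less.prems show ?case by auto
      qed (use x in auto)
      define y where "y = (bracket v ^^ j) x"
      have y: "y \<in> N" "y \<notin> H" "\<And>h. h \<in> K \<Longrightarrow> bracket h y \<in> H" "bracket v y \<in> H"
        using W[of j] j by (auto simp: y_def)
      let ?K' = "sum_set K (span {v})"
      have subK': "subspace ?K'" using subK by (intro subspace_sum_set) auto
      have upper: "K \<subseteq> ?K'" "v \<in> ?K'"
        using sum_set_upper[OF subK, of "span {v}"] span_base[of v "{v}"] by auto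
      have "P ?K'"
        unfolding P_def
      proof (intro conjI ballI bexI[of _ y] subK')
        show "?K' \<subseteq> H" using KH v less.prems(1) by (intro sum_set_least span_minimal) auto
        fix s assume "s \<in> ?K'"
        then obtain k c where s: "s = k + scale c v" "k \<in> K" by (auto simp: sum_set_def span_singleton)
        show "bracket s y \<in> H"
          using s y less.prems(1) by (simp add: bracket_linear subspace_add subspace_scale)
        fix t assume "t \<in> ?K'"
        then obtain l d where t: "t = l + scale d v" "l \<in> K" by (auto simp: sum_set_def span_singleton)
        have "bracket s t = bracket k l + scale d (bracket k v) - scale c (bracket l v)"
          using bracket_swap[of v l] by (simp add: s t bracket_linear algebra_simps)
        also have "\<dots> \<in> K"
          using s t v subK clK by (intro subspace_diff subspace_add subspace_scale) auto
        finally show "bracket s t \<in> ?K'" using upper by blast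
      qed (use y in auto)
      then have "dim ?K' \<le> dim K" by (rule K(2))
      moreover have "dim K < dim ?K'"
        using upper v(2) by (intro subspace_psubset_dim subK subK') blast
      ultimately show ?thesis by simp
    qed
  qed
  then show thesis using that by blast
qed

lemma restricted_subalgebra_normalizer:
  assumes M: "subspace M"
  shows "restricted_subalgebra {y. \<forall>m\<in>M. bracket y m \<in> M}" (is "restricted_subalgebra ?N")
  unfolding restricted_subalgebra_def
proof (intro conjI ballI)
  show "subspace ?N"
    by (rule subspaceI)
      (simp_all add: bracket_linear subspace_0[OF M] subspace_add[OF M] subspace_scale[OF M])
  show "bracket x y \<in> ?N" if "x \<in> ?N" "y \<in> ?N" for x y
    using that by (simp add: bracket_bracket subspace_diff[OF M])
  show "pmap x \<in> ?N" if "x \<in> ?N" for x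
    using that by (auto simp: ad_pmap intro!: funpow_bracket_mem)
qed

text \<open>Engel's theorem gives \<open>x\<close> normalizing \<open>M\<close>, but x^[p] may leave
  \<open>M\<close> plus the line of \<open>x\<close>. As the normalizer is restricted,
  \<open>x\<close> may be exchanged for an eigenvector \<open>v\<close> of the p-map modulo
  \<open>M\<close> inside \<open>cyclic x\<close>.\<close>

lemma ad_nilpotent_extend:
  assumes nil: "ad_nilpotent" and M: "restricted_subalgebra M" and N: "restricted_subalgebra N"
    and MN: "M \<subset> N"
  obtains v where "v \<in> N" "v \<notin> M" "restricted_subalgebra (sum_set M (span {v}))"
proof -
  note subM = restricted_subalgebraD(1)[OF M]
  obtain x where x: "x \<in> N" "x \<notin> M" "\<And>h. h \<in> M \<Longrightarrow> bracket h x \<in> M"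
    using engel[OF nil subM _ restricted_subalgebraD(1)[OF N] MN] MN
      restricted_subalgebraD(2)[OF M] restricted_subalgebraD(2)[OF N] by blast
  have "bracket x m \<in> M" if "m \<in> M" for m
    using x(3)[OF that] bracket_swap[of x m] subspace_neg[OF subM] by simp
  then have norm: "cyclic x \<subseteq> {y. \<forall>m\<in>M. bracket y m \<in> M}"
    using restricted_subalgebra_normalizer[OF subM] by (intro cyclic_least) auto
  obtain v \<epsilon> where v: "v \<in> cyclic x" "v \<notin> M" "pmap v - scale \<epsilon> v \<in> M"
    using pmap_eigenvector_mod[OF M x(2)] by blast
  then have vM: "\<And>m. m \<in> M \<Longrightarrow> bracket v m \<in> M" using norm by auto
  let ?K = "sum_set M (span {v})"
  have subK: "subspace ?K" using subM by (intro subspace_sum_set) auto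
  have upper: "M \<subseteq> ?K" using sum_set_upper[OF subM, of "span {v}"] by auto
  have "restricted_subalgebra ?K"
    unfolding restricted_subalgebra_def
  proof (intro conjI ballI subK)
    fix s assume "s \<in> ?K"
    then obtain k c where s: "s = k + scale c v" "k \<in> M" by (auto simp: sum_set_def span_singleton)
    have stable: "bracket (scale c v) m \<in> M" if "m \<in> M" for m
      using vM[OF that] subM by (simp add: bracket_linear subspace_scale)
    obtain r where r: "r \<in> M" "pmap s = pmap k + pmap (scale c v) + r"
      unfolding s(1)
      by (rule pmap_add_mem[OF subM stable[OF s(2)] restricted_subalgebraD(2)[OF M s(2)] stable])
    have "pmap s = (pmap k + r + scale (c ^ CHAR('k)) (pmap v - scale \<epsilon> v)) + scale (c ^ CHAR('k) * \<epsilon>) v"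
      by (simp add: r pmap_scale algebra_simps)
    moreover have "pmap k + r + scale (c ^ CHAR('k)) (pmap v - scale \<epsilon> v) \<in> M"
      using r s v(3) M by (intro restricted_subalgebraD(5,6)) (auto intro: restricted_subalgebraD)
    ultimately show "pmap s \<in> ?K" by (auto intro!: sum_setI simp: span_singleton)
    fix t assume "t \<in> ?K"
    then obtain l d where t: "t = l + scale d v" "l \<in> M" by (auto simp: sum_set_def span_singleton)
    have "bracket s t = bracket k l - scale d (bracket v k) + scale c (bracket v l)"
      using bracket_swap[of k v] by (simp add: s t bracket_linear algebra_simps)
    also have "\<dots> \<in> M"
      using s t vM M by (intro restricted_subalgebraD(5-7)) (auto intro: restricted_subalgebraD)
    finally show "bracket s t \<in> ?K" using upper by blast
  qed
  moreover have "v \<in> N" using v cyclic_least[OF x(1) N] by blast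
  ultimately show thesis using v that by blast
qed

lemma ad_nilpotent_cover:
  assumes nil: "ad_nilpotent" and max: "maximal_in S U" "restricted_subalgebra U" and w: "w \<in> U" "w \<notin> S"
  shows "U = sum_set S (span {w})"
proof -
  have S: "restricted_subalgebra S" "S \<subset> U" using max by (auto simp: maximal_in_def)
  note subS = restricted_subalgebraD(1)[OF S(1)]
  obtain v where v: "v \<in> U" "v \<notin> S" "restricted_subalgebra (sum_set S (span {v}))"
    using ad_nilpotent_extend[OF nil S(1) max(2) S(2)] by blast
  have "sum_set S (span {v}) \<subseteq> U"
    using S v by (intro sum_set_least span_minimal restricted_subalgebraD(1)[OF max(2)]) auto
  moreover have "S \<subset> sum_set S (span {v})"
    using sum_set_upper[OF subS, of "span {v}"] span_base[of v "{v}"] v(2) by auto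
  ultimately have U: "U = sum_set S (span {v})" using max(1) v(3) unfolding maximal_in_def by blast
  then obtain s c where sc: "s \<in> S" "w = s + scale c v" using w by (auto simp: sum_set_def span_singleton)
  have "c \<noteq> 0" using sc w by auto
  have "v \<in> sum_set S (span {w})"
  proof -
    have "scale c v = w - s" using sc by simp
    then have "scale (inverse c) (scale c v) = scale (inverse c) (w - s)" by simp
    then have "v = scale (- inverse c) s + scale (inverse c) w"
      using \<open>c \<noteq> 0\<close> by (simp add: algebra_simps)
    moreover have "scale (- inverse c) s + scale (inverse c) w \<in> sum_set S (span {w})"
      using sc(1) by (intro sum_setI subspace_scale subS span_scale span_base) auto
    ultimately show ?thesis by (rule ssubst)
  qed
  then have "U \<subseteq> sum_set S (span {w})"
    unfolding U using sum_set_upper[OF subS, of "span {w}"] subspace_sum_set[OF subS, of "span {w}"]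
    by (intro sum_set_least span_minimal) auto
  moreover have "sum_set S (span {w}) \<subseteq> U"
    using S w by (intro sum_set_least span_minimal restricted_subalgebraD(1)[OF max(2)]) auto
  ultimately show ?thesis by blast
qed

text \<open>Induction on \<open>dim T\<close>: for \<open>R\<close> maximal in \<open>T\<close>, the
  join of \<open>S\<close> and \<open>R\<close> is already a sum, and semimodularity with
  \<open>ad_nilpotent_cover\<close> shows that adding \<open>T\<close> raises the dimension by at
  most one.\<close>

lemma ad_nilpotent_join_eq_sum:
  assumes nil: "ad_nilpotent" and usm: "upper_semimodular"
    and S: "restricted_subalgebra S" and T: "restricted_subalgebra T"
  shows "generated (S \<union> T) = sum_set S T"
proof
  note subS = restricted_subalgebraD(1)[OF S]
  show "sum_set S T \<subseteq> generated (S \<union> T)"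
    using generated_superset[of "S \<union> T"]
    by (intro sum_set_least restricted_subalgebraD(1)) auto
  show "generated (S \<union> T) \<subseteq> sum_set S T"
    using T
  proof (induction "dim T" arbitrary: T rule: less_induct)
    case less
    note T = less.prems and subT = restricted_subalgebraD(1)[OF less.prems]
    note upper = sum_set_upper[OF subS subT]
    show ?case
    proof (cases "T \<subseteq> S")
      case True
      then show ?thesis using upper S by (meson Un_least generated_least order_refl order_trans)
    next
      case False
      define P where "P R \<longleftrightarrow> restricted_subalgebra R \<and> S \<inter> T \<subseteq> R \<and> R \<subset> T" for R
      have "P (S \<inter> T)" using False restricted_subalgebra_Int[OF S T] by (auto simp: P_def)
      then have "\<exists>R. P R \<and> (\<forall>R'. P R' \<longrightarrow> dim R' \<le> dim R)"
        by (rule ex_has_greatest_nat[where b = "Suc dimension"]) (simp add: dim_subset_UNIV less_Suc_eq_le)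
      then obtain R where R: "P R" "\<And>R'. P R' \<Longrightarrow> dim R' \<le> dim R" by blast
      then have R': "restricted_subalgebra R" "R \<subset> T" "S \<inter> T \<subseteq> R" by (auto simp: P_def)
      note subR = restricted_subalgebraD(1)[OF R'(1)]
      have max: "maximal_in R T"
        unfolding maximal_in_def
      proof (intro conjI notI R')
        assume "\<exists>N. restricted_subalgebra N \<and> R \<subset> N \<and> N \<subset> T"
        then obtain N where N: "restricted_subalgebra N" "R \<subset> N" "N \<subset> T" by blast
        then have "P N" using R' by (auto simp: P_def)
        then show False
          using R(2) subspace_psubset_dim[OF subR restricted_subalgebraD(1)[OF N(1)] N(2)] by force
      qed
      let ?S' = "generated (S \<union> R)"
      have S': "restricted_subalgebra ?S'" by (rule restricted_subalgebra_generated)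
      have RS': "S \<subseteq> ?S'" "R \<subseteq> ?S'" using generated_superset[of "S \<union> R"] by auto
      have "dim R < dim T" using subR subT R'(2) by (rule subspace_psubset_dim)
      then have "?S' \<subseteq> sum_set S R" using less.hyps R' by blast
      also have "\<dots> \<subseteq> sum_set S T" using R'(2) by (auto simp: sum_set_def)
      finally have S'_sub: "?S' \<subseteq> sum_set S T" .
      have "generated (?S' \<union> T) \<subseteq> sum_set S T"
      proof (cases "T \<subseteq> ?S'")
        case True
        then have "generated (?S' \<union> T) \<subseteq> ?S'" by (intro generated_least S') auto
        with S'_sub show ?thesis by blast
      next
        case F: False
        then obtain w where w: "w \<in> T" "w \<notin> ?S'" by blast
        have "?S' \<inter> T = R"
          using max restricted_subalgebra_Int[OF S' T] RS' R'(2) F unfolding maximal_in_def by blast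
        then have "maximal_in ?S' (generated (?S' \<union> T))"
          using usm max S' T unfolding upper_semimodular_def upper_semimodular_in_def by metis
        then have "generated (?S' \<union> T) = sum_set ?S' (span {w})"
          using w generated_superset[of "?S' \<union> T"] by (intro ad_nilpotent_cover[OF nil]) auto
        also have "\<dots> \<subseteq> sum_set S T"
          using S'_sub w upper subspace_sum_set[OF subS subT]
          by (intro sum_set_least span_minimal) auto
        finally show ?thesis .
      qed
      moreover have "generated (S \<union> T) \<subseteq> generated (?S' \<union> T)"
        using RS' generated_superset[of "?S' \<union> T"] by (intro generated_least) auto
      ultimately show ?thesis by blast
    qed
  qed
qed

section \<open>Nilpotency class\<close>

text \<open>Provides a nilpotency exponent uniform in all vectors and maps, as the start of the
  descending induction on p-powers requires.\<close>

lemma funpow_nilpotent_dimension: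
  fixes f :: "'v \<Rightarrow> 'v"
  assumes add: "\<And>x y. f (x + y) = f x + f y" and scale: "\<And>c x. f (scale c x) = scale c (f x)"
    and nil: "(f ^^ n) y = 0"
  shows "(f ^^ dimension) y = 0"
proof (rule ccontr)
  assume nz: "(f ^^ dimension) y \<noteq> 0"
  define e where "e i = (f ^^ i) y" for i
  have f0: "(f ^^ k) 0 = 0" for k
    by (induction k) (use scale[of 0 0] in auto)
  have e_mono: "e i = 0 \<Longrightarrow> e (k + i) = 0" for i k
    by (simp add: e_def funpow_add f0)
  obtain N where N: "e N = 0" "\<And>i. i < N \<Longrightarrow> e i \<noteq> 0"
    using exists_least_iff[of "\<lambda>n. e n = 0"] nil by (auto simp: e_def)
  have "dimension < N"
    using nz e_mono[of N "dimension - N"] N(1) by (cases "dimension < N") (auto simp: e_def)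
  define U where "U i = e ` {i..}" for i
  \<comment> \<open>The power \<open>N - 1 - i\<close> of \<open>f\<close> kills all later iterates
    but sends \<open>e i\<close> to the nonzero \<open>e (N - 1)\<close>.\<close>
  have new: "e i \<notin> span (U (Suc i))" if "i < N" for i
  proof
    assume mem: "e i \<in> span (U (Suc i))"
    have sub: "subspace {z. (f ^^ (N - 1 - i)) z = 0}"
    proof (rule subspaceI)
      have "(f ^^ k) (x + y) = (f ^^ k) x + (f ^^ k) y" "(f ^^ k) (scale c x) = scale c ((f ^^ k) x)"
        for k x y c by (induction k) (simp_all add: add scale)
      then show "x + y \<in> {z. (f ^^ (N - 1 - i)) z = 0}" "scale c x \<in> {z. (f ^^ (N - 1 - i)) z = 0}"
        if "x \<in> {z. (f ^^ (N - 1 - i)) z = 0}" "y \<in> {z. (f ^^ (N - 1 - i)) z = 0}" for x y c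
        using that by auto
    qed (simp add: f0)
    have "(f ^^ (N - 1 - i)) (e j) = 0" if "j \<ge> Suc i" for j
    proof -
      have "(f ^^ (N - 1 - i)) (e j) = e ((N - 1 - i + j - N) + N)"
        using that \<open>i < N\<close> by (simp add: e_def add.commute flip: funpow_add comp_apply[of "f ^^ _" "f ^^ _"])
      then show ?thesis using e_mono[OF N(1)] by simp
    qed
    then have "span (U (Suc i)) \<subseteq> {z. (f ^^ (N - 1 - i)) z = 0}"
      using sub by (intro span_minimal) (auto simp: U_def)
    with mem have "(f ^^ (N - 1 - i)) (e i) = 0" by blast
    moreover have "(f ^^ (N - 1 - i)) (e i) = e (N - 1)"
      using \<open>i < N\<close> by (simp add: e_def flip: funpow_add comp_apply[of "f ^^ _" "f ^^ _"])
    ultimately show False using N(2)[of "N - 1"] that by simp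
  qed
  have "k \<le> dim (U (N - k))" if "k \<le> N" for k
    using that
  proof (induction k)
    case (Suc k)
    then have eq: "Suc (N - Suc k) = N - k" by simp
    have "span (U (N - k)) \<subseteq> span (U (N - Suc k))"
      by (intro span_mono) (auto simp: U_def)
    moreover have "e (N - Suc k) \<in> span (U (N - Suc k))"
      by (intro span_base) (auto simp: U_def)
    ultimately have "dim (U (N - k)) < dim (U (N - Suc k))"
      using new[of "N - Suc k"] Suc.prems unfolding eq by (intro dim_psubset) auto
    with Suc show ?case by simp
  qed simp
  from this[of N] have "N \<le> dim (U 0)" by simp
  with dim_subset_UNIV[of "U 0"] \<open>dimension < N\<close> show False by simp
qed

lemma bracket_funpow_pmap: "bracket ((pmap ^^ k) x) y = (bracket x ^^ (CHAR('k) ^ k)) y"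
proof (induction k arbitrary: y)
  case (Suc k)
  then have "bracket ((pmap ^^ k) x) = bracket x ^^ (CHAR('k) ^ k)" by blast
  then show ?case by (simp add: ad_pmap funpow_mult mult.commute)
qed simp

lemma pmap_add_char_2:
  assumes "CHAR('k) = 2"
  shows "pmap (x + y) = pmap x + pmap y + bracket y x"
  using pmap_add[of x y] unfolding assms jacobson_term_def by (simp add: coeff_ad_poly assms)

text \<open>A nilpotent map induced modulo \<open>R\<close> has no nonzero eigenvalue, so either
  \<open>c = 0\<close> or \<open>x\<close> is in \<open>R\<close>.\<close>

lemma nilpotent_shift_eigenvalue:
  assumes nil: "ad_nilpotent" and R: "subspace R" "\<forall>r\<in>R. bracket q r \<in> R"
    and x: "bracket q x - scale c x \<in> R"
  shows "bracket q x \<in> R"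
proof (cases "x \<in> R \<or> c = 0")
  case False
  have "(bracket q ^^ n) x - scale (c ^ n) x \<in> R" for n
  proof (induction n)
    case (Suc n)
    have "(bracket q ^^ Suc n) x - scale (c ^ Suc n) x =
        bracket q ((bracket q ^^ n) x - scale (c ^ n) x) + scale (c ^ n) (bracket q x - scale c x)"
      by (simp add: bracket_linear algebra_simps)
    also have "\<dots> \<in> R" by (intro subspace_add[OF R(1)] R(2)[rule_format] Suc subspace_scale[OF R(1)] x)
    finally show ?case .
  qed (simp add: subspace_0[OF R(1)])
  moreover obtain n where "(bracket q ^^ n) x = 0" using nil unfolding ad_nilpotent_def by blast
  ultimately have "- scale (c ^ n) x \<in> R" by (metis diff_0)
  then have "scale (- inverse (c ^ n)) (- scale (c ^ n) x) \<in> R" by (rule subspace_scale[OF R(1)])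
  with False show ?thesis by simp
qed (use x R in auto)

lemma sum_set_commute: "sum_set S T = sum_set T S"
proof -
  have "sum_set S T \<subseteq> sum_set T S" for S T :: "'v set"
  proof
    fix x assume "x \<in> sum_set S T"
    then obtain s t where "x = t + s" "s \<in> S" "t \<in> T" by (auto simp: sum_set_def add.commute)
    then show "x \<in> sum_set T S" by (simp add: sum_setI)
  qed
  then show ?thesis by blast
qed

lemma cyclic_memE:
  assumes "z \<in> cyclic x"
  obtains c w where "z = scale c x + w" "w \<in> cyclic (pmap x)"
  using assms unfolding cyclic_decompose[of x] by (auto simp: sum_set_def span_singleton)

section \<open>Quasi-ideals and nilpotency: p-powers are central\<close>

context
  assumes nil: "ad_nilpotent"
    and quasi: "\<And>S T s t. restricted_subalgebra S \<Longrightarrow> restricted_subalgebra T \<Longrightarrow>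
      s \<in> S \<Longrightarrow> t \<in> T \<Longrightarrow> bracket s t \<in> sum_set S T"
begin

text \<open>The quasi-ideal condition makes \<open>x\<close> an eigenvector of ad q modulo
  \<open>?Q\<close>, and nilpotency of ad q removes the eigenvalue.\<close>

lemma frattini_stable:
  assumes q: "q \<in> sum_set (cyclic (pmap x)) (cyclic (pmap y))" (is "q \<in> ?Q")
  shows "bracket q x \<in> ?Q" "bracket x q \<in> ?Q"
proof -
  have Q: "restricted_subalgebra ?Q"
    by (intro restricted_subalgebra_sum quasi cyclic_restricted)
  from q obtain a b where ab: "q = a + b" "a \<in> cyclic (pmap x)" "b \<in> cyclic (pmap y)"
    by (auto simp: sum_set_def)
  have "bracket x b \<in> sum_set (cyclic x) (cyclic (pmap y))"
    using ab by (intro quasi cyclic_restricted cyclic_self)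
  then obtain z w where zw: "bracket x b = z + w" "z \<in> cyclic x" "w \<in> cyclic (pmap y)"
    by (auto simp: sum_set_def)
  then obtain c z' where z: "z = scale c x + z'" "z' \<in> cyclic (pmap x)" by (auto elim: cyclic_memE)
  have "bracket a x = 0" using ab cyclic_pmap_subset cyclic_self by (intro cyclic_abelian[of a x]) auto
  then have "bracket q x - scale (- c) x = - (z' + w)"
    using bracket_swap[of b x] by (simp add: ab zw z bracket_linear)
  moreover have "- (z' + w) \<in> ?Q"
    using z zw by (intro restricted_subalgebraD(8)[OF Q] sum_setI)
  ultimately have "bracket q x - scale (- c) x \<in> ?Q" by simp
  then show "bracket q x \<in> ?Q"
    by (rule nilpotent_shift_eigenvalue[OF nil restricted_subalgebraD(1)[OF Q], rotated])
      (use restricted_subalgebraD(2)[OF Q q] in auto)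
  then show "bracket x q \<in> ?Q"
    using restricted_subalgebraD(8)[OF Q] bracket_swap[of x q] by metis
qed

lemma bracket_mem_frattini: "bracket x y \<in> sum_set (cyclic (pmap x)) (cyclic (pmap y))" (is "_ \<in> ?Q")
proof -
  have Q: "restricted_subalgebra ?Q"
    by (intro restricted_subalgebra_sum quasi cyclic_restricted)
  note subQ = restricted_subalgebraD(1)[OF Q]
  have stable: "bracket x q \<in> ?Q" "bracket y q \<in> ?Q" if "q \<in> ?Q" for q
    using frattini_stable(2)[OF that] frattini_stable(2)[of q y x] that
    by (simp_all add: sum_set_commute[of "cyclic (pmap y)"])
  have "bracket x y \<in> sum_set (cyclic x) (cyclic y)" by (intro quasi cyclic_restricted cyclic_self)
  then obtain z w where "bracket x y = z + w" "z \<in> cyclic x" "w \<in> cyclic y"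
    by (auto simp: sum_set_def)
  then obtain \<alpha> \<beta> z' w' where eq: "bracket x y = (scale \<alpha> x + z') + (scale \<beta> y + w')"
    and "z' \<in> cyclic (pmap x)" "w' \<in> cyclic (pmap y)" by (metis cyclic_memE)
  \<comment> \<open>Modulo \<open>?Q\<close> the bracket is \<open>v\<close>, so [x, v] and [y, v]
    are multiples of \<open>v\<close> by \<beta> and -\<alpha>. A nonzero factor would be an
    eigenvalue of a nilpotent map unless \<open>v\<close> is in \<open>?Q\<close>.\<close>
  define v q where "v = scale \<alpha> x + scale \<beta> y" and "q = z' + w'"
  have q: "q \<in> ?Q" unfolding q_def by (intro sum_setI) fact+
  have vq: "bracket x y = v + q" by (simp add: eq v_def q_def)
  have xv: "bracket x v = scale \<beta> (bracket x y)" by (simp add: v_def bracket_linear)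
  have yv: "bracket y v = scale (- \<alpha>) (bracket x y)"
    using bracket_swap[of y x] by (simp add: v_def bracket_linear)
  consider "\<alpha> \<noteq> 0" | "\<beta> \<noteq> 0" | "\<alpha> = 0" "\<beta> = 0" by blast
  then show ?thesis
  proof cases
    case 1
    have "bracket y v - scale (- \<alpha>) v = scale (- \<alpha>) q" by (simp add: yv vq algebra_simps)
    then have "bracket y v - scale (- \<alpha>) v \<in> ?Q" using subspace_scale[OF subQ q] by (simp del: scale_minus_left)
    then have "bracket y v \<in> ?Q" by (rule nilpotent_shift_eigenvalue[OF nil subQ, rotated]) (use stable in auto)
    then have "scale (- inverse \<alpha>) (bracket y v) \<in> ?Q" by (rule subspace_scale[OF subQ])
    then show ?thesis using 1 by (simp add: yv)
  next
    case 2
    have "bracket x v - scale \<beta> v = scale \<beta> q" by (simp add: xv vq algebra_simps)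
    then have "bracket x v - scale \<beta> v \<in> ?Q" using subspace_scale[OF subQ q] by (simp del: scale_minus_left)
    then have "bracket x v \<in> ?Q" by (rule nilpotent_shift_eigenvalue[OF nil subQ, rotated]) (use stable in auto)
    then have "scale (inverse \<beta>) (bracket x v) \<in> ?Q" by (rule subspace_scale[OF subQ])
    then show ?thesis using 2 by (simp add: xv)
  next
    case 3
    then show ?thesis using q vq by (simp add: v_def)
  qed
qed

text \<open>With u the k-th p-power of y, facts \<open>a\<close>, \<open>b\<close>, \<open>c\<close>
  successively improve what commutes with \<open>u\<close>, each by expanding a bracket through
  \<open>bracket_mem_frattini\<close> and squaring an ad map. They give (ad u)^3 x = 0, which
  settles p >= 3.\<close>

lemma funpow_pmap_central_step:
  assumes central: "\<And>x y. bracket ((pmap ^^ Suc (Suc k)) x) y = 0"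
  shows "bracket ((pmap ^^ Suc k) y) x = 0"
proof -
  define u where "u = (pmap ^^ k) y"
  have ppu: "bracket (pmap (pmap u)) z = 0" for z
    using central[of y z] by (simp add: u_def)
  have comm_swap: "bracket a b = 0 \<longleftrightarrow> bracket b a = 0" for a b
    using bracket_swap[of a b] by auto
  have cyc_self: "bracket x w = 0" if "w \<in> cyclic (pmap x)" for x w
    using that cyclic_pmap_subset cyclic_self by (intro cyclic_abelian[of x x w]) auto
  have sq: "bracket (pmap z) w = 0" if "bracket z (bracket z w) = 0" for z w
    unfolding ad_pmap by (rule funpow_bracket_eq_0[where m = 2]) (use that char_ge_2 in \<open>simp_all add: numeral_2_eq_2\<close>)
  have a: "bracket (pmap x) (pmap u) = 0" for x
  proof (rule sq)
    obtain z w where "bracket (pmap u) x = z + w" "z \<in> cyclic (pmap (pmap u))" "w \<in> cyclic (pmap x)"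
      using bracket_mem_frattini[of "pmap u" x] by (auto simp: sum_set_def)
    then have "bracket x (bracket (pmap u) x) = 0"
      using cyclic_commute[OF ppu] cyc_self by (simp add: bracket_linear comm_swap[of x z])
    then show "bracket x (bracket x (pmap u)) = 0"
      using bracket_swap[of x "pmap u"] by (simp add: bracket_linear)
  qed
  have b: "bracket (pmap (pmap x)) u = 0" for x
  proof (rule sq)
    obtain z w where "bracket (pmap x) u = z + w" "z \<in> cyclic (pmap (pmap x))" "w \<in> cyclic (pmap u)"
      using bracket_mem_frattini[of "pmap x" u] by (auto simp: sum_set_def)
    then show "bracket (pmap x) (bracket (pmap x) u) = 0"
      using cyc_self cyclic_commute[of "pmap u" "pmap x" w] a[of x]
      by (simp add: bracket_linear comm_swap[of "pmap x"])
  qed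
  have c: "bracket u (bracket u (pmap x)) = 0" for x
  proof -
    obtain z w where "bracket u (pmap x) = z + w" "z \<in> cyclic (pmap u)" "w \<in> cyclic (pmap (pmap x))"
      using bracket_mem_frattini[of u "pmap x"] by (auto simp: sum_set_def)
    then show ?thesis
      using cyc_self cyclic_commute[OF b] by (simp add: bracket_linear comm_swap[of u w])
  qed
  have decomp: "\<exists>\<alpha> \<beta> z w. bracket x u = scale \<alpha> (pmap x) + z + (scale \<beta> (pmap u) + w) \<and>
      z \<in> cyclic (pmap (pmap x)) \<and> w \<in> cyclic (pmap (pmap u))" for x
  proof -
    obtain z w where "bracket x u = z + w" "z \<in> cyclic (pmap x)" "w \<in> cyclic (pmap u)"
      using bracket_mem_frattini[of x u] by (auto simp: sum_set_def)
    then show ?thesis by (metis cyclic_memE)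
  qed
  obtain \<alpha> \<beta> z w where xu: "bracket x u = scale \<alpha> (pmap x) + z + (scale \<beta> (pmap u) + w)"
    "z \<in> cyclic (pmap (pmap x))" "w \<in> cyclic (pmap (pmap u))" using decomp by blast
  have zu: "bracket u z = 0" using cyclic_commute[OF b xu(2)] comm_swap by blast
  have w0: "bracket v w = 0" for v using cyclic_commute[OF ppu xu(3)] comm_swap by blast
  have xz: "bracket x z = 0"
    using xu(2) cyclic_pmap_subset by (intro cyc_self) auto
  have selfp: "bracket v (pmap v) = 0" for v using cyc_self[OF cyclic_self] .
  have uxu: "bracket u (bracket x u) = scale \<alpha> (bracket u (pmap x))"
    by (simp add: xu bracket_linear zu w0 selfp)
  have xxu: "bracket x (bracket x u) = scale \<beta> (bracket x (pmap u))"
    by (simp add: xu bracket_linear xz w0 selfp)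
  have "bracket (pmap u) x = 0"
  proof (cases "CHAR('k) = 2")
    case False
    then have "CHAR('k) \<ge> 3" using char_ge_2 by simp
    have "bracket u (bracket u (bracket u x)) = 0"
      using uxu c[of x] bracket_swap[of u x] by (simp add: bracket_linear)
    then have "(bracket u ^^ 3) x = 0" by (simp add: numeral_3_eq_3)
    then show ?thesis
      unfolding ad_pmap using \<open>CHAR('k) \<ge> 3\<close> by (rule funpow_bracket_eq_0)
  next
    case char2: True
    show ?thesis
    proof (rule ccontr)
      define D where "D = bracket (pmap u) x"
      assume "bracket (pmap u) x \<noteq> 0"
      then have D: "D \<noteq> 0" by (simp add: D_def)
      have "D = bracket u (bracket u x)" by (simp add: D_def ad_pmap char2 numeral_2_eq_2)
      also have "\<dots> = - bracket u (bracket x u)" using bracket_swap[of u x] by (simp add: bracket_linear)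
      finally have D1: "bracket u (bracket x u) = - D" by simp
      have "bracket (pmap x) u = bracket x (bracket x u)" by (simp add: ad_pmap char2 numeral_2_eq_2)
      also have "\<dots> = - scale \<beta> D" using xxu bracket_swap[of x "pmap u"] by (simp add: D_def)
      finally have "bracket u (pmap x) = scale \<beta> D" using bracket_swap[of u "pmap x"] by simp
      with uxu D1 have "scale (\<alpha> * \<beta>) D = - D" by simp
      then have "scale (\<alpha> * \<beta> + 1) D = 0" unfolding scale_left_distrib by simp
      then have "\<alpha> * \<beta> + 1 = 0" using D by simp
      then have ab: "\<alpha> * \<beta> = -1" by (simp add: add_eq_0_iff2)
      \<comment> \<open>Since \<alpha> \<beta> = -1, this scaling matches [x', u] with the p-powers
        of x' and u, so that they cancel in (x' + u)^[2]. What remains commutes with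
        \<open>u\<close>, forcing [u, [x', u]] = 0 against \<open>D \<noteq> 0\<close>.\<close>
      define x' where "x' = scale \<alpha> x"
      have two: "v + v = 0" for v :: 'v
      proof -
        have "of_nat 2 = (0 :: 'k)" using of_nat_CHAR[where ?'a = 'k] char2 by simp
        then have "scale (1 + 1) v = 0" by simp
        then show ?thesis unfolding scale_left_distrib by simp
      qed
      have x'u: "bracket x' u = pmap x' - pmap u + scale \<alpha> (z + w)"
      proof -
        have "bracket x' u = scale (\<alpha>^2) (pmap x) + scale (\<alpha> * \<beta>) (pmap u) + scale \<alpha> (z + w)"
          by (simp add: x'_def bracket_linear xu algebra_simps power2_eq_square)
        then show ?thesis by (simp add: x'_def pmap_scale char2 ab)
      qed
      have "pmap (x' + u) = pmap x' + pmap u + bracket u x'" by (rule pmap_add_char_2[OF char2])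
      also have "\<dots> = (pmap u + pmap u) - scale \<alpha> (z + w)"
        using bracket_swap[of u x'] x'u by simp
      finally have "pmap (x' + u) = - scale \<alpha> (z + w)" using two by simp
      then have "bracket (pmap (x' + u)) u = 0"
        using zu w0[of u] comm_swap[of u] by (simp add: bracket_linear)
      moreover obtain r s where rs: "bracket (x' + u) u = r + s" "r \<in> cyclic (pmap (x' + u))" "s \<in> cyclic (pmap u)"
        using bracket_mem_frattini[of "x' + u" u] by (auto simp: sum_set_def)
      ultimately have "bracket r u = 0" by (intro cyclic_commute[of "pmap (x' + u)" u r])
      then have "bracket u r = 0" by (simp add: comm_swap[of u r])
      then have "bracket u (bracket (x' + u) u) = 0"
        using cyc_self[OF rs(3)] unfolding rs(1) by (simp add: bracket_linear)
      then have "scale \<alpha> (bracket u (bracket x u)) = 0" by (simp add: x'_def bracket_linear)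
      with D1 D ab show False by auto
    qed
  qed
  then show ?thesis by (simp add: u_def)
qed

lemma pmap_central: "bracket (pmap x) y = 0"
proof -
  have base: "bracket ((pmap ^^ Suc dimension) x) y = 0" for x y
  proof -
    obtain n where "(bracket x ^^ n) y = 0" using nil unfolding ad_nilpotent_def by blast
    then have "(bracket x ^^ dimension) y = 0"
      by (rule funpow_nilpotent_dimension[rotated 2]) (simp_all add: bracket_linear)
    moreover have "dimension \<le> CHAR('k) ^ Suc dimension"
      using char_ge_2 by (meson less_exp less_imp_le lessI order_trans power_mono zero_le)
    ultimately show ?thesis unfolding bracket_funpow_pmap by (rule funpow_bracket_eq_0)
  qed
  \<comment> \<open>Growing \<open>k\<close> lowers the number of applications of the p-map, from
    \<open>Suc dimension\<close> down to one.\<close>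
  have "\<forall>x y. bracket ((pmap ^^ Suc (dimension - k)) x) y = 0" if "k \<le> dimension" for k
    using that
  proof (induction k)
    case (Suc k)
    then have "Suc (dimension - k) = Suc (Suc (dimension - Suc k))" by simp
    with Suc show ?case using funpow_pmap_central_step[of "dimension - Suc k"] by simp
  qed (use base in simp)
  from this[of dimension] show ?thesis by simp
qed

lemma nilpotent_class_2: "nilpotent_class_le 2"
proof -
  have central: "bracket z (bracket x y) = 0" for x y z
  proof -
    obtain a b where ab: "bracket x y = a + b" "a \<in> cyclic (pmap x)" "b \<in> cyclic (pmap y)"
      using bracket_mem_frattini[of x y] by (auto simp: sum_set_def)
    then have "bracket a z = 0" "bracket b z = 0"
      using cyclic_commute[OF pmap_central] by blast+
    then show ?thesis using bracket_swap[of z a] bracket_swap[of z b] by (simp add: ab bracket_linear)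
  qed
  have "bracket_span UNIV UNIV \<subseteq> {y. bracket z y = 0}" for z
    using central by (subst bracket_span_subset_iff) (auto intro: subspace_centralizer)
  then have "bracket_span UNIV (bracket_span UNIV UNIV) \<subseteq> {0}"
    by (subst bracket_span_subset_iff) auto
  moreover have "0 \<in> bracket_span UNIV (bracket_span UNIV UNIV)"
    unfolding bracket_span_def by (rule span_zero)
  ultimately show ?thesis
    unfolding nilpotent_class_le_def numeral_2_eq_2 lower_central.simps by blast
qed

end

section \<open>Toral elements\<close>

lemma atom_fixed: "x \<noteq> 0 \<Longrightarrow> pmap x = scale c x \<Longrightarrow> atom x"
  by (auto simp: atom_def span_singleton)

text \<open>The square-zero case of semisimplicity of ad t: the p-th power of ad t is ad t
  itself.\<close>

lemma toral_square_zero: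
  assumes "pmap t = t" "bracket t (bracket t z) = 0"
  shows "bracket t z = 0"
proof -
  have "(bracket t ^^ 2) z = 0" using assms by (simp add: numeral_2_eq_2)
  then have "(bracket t ^^ CHAR('k)) z = 0" using char_ge_2 by (rule funpow_bracket_eq_0)
  then show ?thesis using ad_pmap[of t z] assms by simp
qed

lemma pmap_weight_vector_commutes:
  assumes "bracket t x = scale c x"
  shows "bracket t (pmap x) = 0"
proof -
  have "(bracket x ^^ 2) t = 0"
    using assms bracket_swap[of x t] by (simp add: numeral_2_eq_2 bracket_linear)
  then have "(bracket x ^^ CHAR('k)) t = 0" using char_ge_2 by (rule funpow_bracket_eq_0)
  then show ?thesis using ad_pmap[of x t] bracket_swap[of t "pmap x"] by simp
qed

text \<open>y = [a, b] is an eigenvector of ad a, and t is \<open>a\<close> divided by its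
  eigenvalue. The p-map preserves every line of the plane; its scalars on \<open>a\<close> and
  \<open>t + y\<close> are read off from the action on \<open>y\<close>, and that on
  \<open>y\<close> vanishes because y^[p] commutes with \<open>t\<close>.\<close>

lemma toral_pair_of_atoms_aux:
  assumes usm: "upper_semimodular" and ab: "atom a" "atom b"
    and y: "bracket a b = scale \<alpha> a + scale \<beta> b" "bracket a b \<noteq> 0" "\<beta> \<noteq> 0"
  shows "\<exists>t y. pmap t = t \<and> bracket t y = y \<and> y \<noteq> 0 \<and> pmap y = 0 \<and> pmap (t + y) = t + y"
proof -
  define y where "y = bracket a b"
  have y0: "y \<noteq> 0" using y by (simp add: y_def)
  have ay: "bracket a y = scale \<beta> y" unfolding y_def y(1) by (simp add: bracket_linear y(1))
  obtain \<mu> where \<mu>: "pmap a = scale \<mu> a" using ab by (auto simp: atom_def span_singleton)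
  have "scale (\<mu> * \<beta>) y = bracket (pmap a) y" by (simp add: \<mu> bracket_linear ay)
  also have "\<dots> = scale (\<beta> ^ CHAR('k)) y" unfolding ad_pmap by (rule funpow_bracket_eigenvector[OF ay])
  finally have eq: "\<mu> * \<beta> = \<beta> ^ CHAR('k)" using y0 by simp
  define t where "t = scale (inverse \<beta>) a"
  have "pmap t = scale (inverse (\<beta> ^ CHAR('k)) * \<mu>) a"
    by (simp add: t_def pmap_scale \<mu> power_inverse)
  also have "inverse (\<beta> ^ CHAR('k)) * \<mu> = inverse \<beta>"
    unfolding eq[symmetric] using \<open>\<beta> \<noteq> 0\<close> eq by (auto simp: field_simps)
  finally have pt: "pmap t = t" by (simp add: t_def)
  have ty: "bracket t y = y" using \<open>\<beta> \<noteq> 0\<close> by (simp add: t_def bracket_linear ay)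
  have mem: "y \<in> span {a, b}" "t + y \<in> span {a, b}"
    unfolding y_def y(1) t_def by (intro span_add span_scale span_base; simp)+
  have pm: "pmap x \<in> span {x}" if "x \<in> span {a, b}" for x
    using bracket_atoms(2)[OF usm ab y(2) that] .
  obtain \<nu> where \<nu>: "pmap y = scale \<nu> y" using pm[OF mem(1)] by (auto simp: span_singleton)
  have "scale \<nu> y = bracket t (pmap y)" by (simp add: \<nu> bracket_linear ty)
  also have "\<dots> = 0" by (rule pmap_weight_vector_commutes[of t y 1]) (simp add: ty)
  finally have py: "pmap y = 0" by (simp add: \<nu>)
  obtain \<kappa> where \<kappa>: "pmap (t + y) = scale \<kappa> (t + y)" using pm[OF mem(2)] by (auto simp: span_singleton)
  have tyy: "bracket (t + y) y = scale 1 y" by (simp add: bracket_linear ty)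
  have "scale \<kappa> y = bracket (pmap (t + y)) y" by (simp add: \<kappa> bracket_linear ty)
  also have "\<dots> = y" unfolding ad_pmap funpow_bracket_eigenvector[OF tyy] by simp
  finally have "scale (\<kappa> - 1) y = 0" by (simp add: algebra_simps)
  with y0 have "\<kappa> = 1" by simp
  with pt ty y0 py \<kappa> show ?thesis by (intro exI[of _ t] exI[of _ y]) simp
qed

lemma toral_pair_of_atoms:
  assumes usm: "upper_semimodular" and ab: "atom a" "atom b" "bracket a b \<noteq> 0"
  obtains t y where "pmap t = t" "bracket t y = y" "y \<noteq> 0" "pmap y = 0" "pmap (t + y) = t + y"
proof -
  obtain \<alpha> \<beta> where eq: "bracket a b = scale \<alpha> a + scale \<beta> b"
    using bracket_atoms(1)[OF usm ab(1,2)] by (auto simp: span_pair)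
  have "\<exists>t y. pmap t = t \<and> bracket t y = y \<and> y \<noteq> 0 \<and> pmap y = 0 \<and> pmap (t + y) = t + y"
  proof (cases "\<beta> = 0")
    case False
    then show ?thesis by (rule toral_pair_of_atoms_aux[OF usm ab(1,2) eq ab(3)])
  next
    case True
    then have "\<alpha> \<noteq> 0" using eq ab(3) by auto
    moreover have "bracket b a = scale (- \<beta>) b + scale (- \<alpha>) a"
      using bracket_swap[of b a] by (simp add: eq)
    moreover have "bracket b a \<noteq> 0" using ab(3) bracket_swap[of a b] by auto
    ultimately show ?thesis
      using toral_pair_of_atoms_aux[OF usm ab(2,1), of "- \<beta>" "- \<alpha>"] by simp
  qed
  then show thesis using that by blast
qed

lemma weight_vectors_independent:
  assumes "bracket t y = y" "bracket t z = scale c z" "c \<noteq> 1" "y \<noteq> 0" "z \<noteq> 0"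
    and eq: "scale a y + scale b z = 0"
  shows "a = 0" "b = 0"
proof -
  have "bracket t (scale a y + scale b z) = 0" unfolding eq by simp
  then have "scale a y + scale (b * c) z = 0" using assms(1,2) by (simp add: bracket_linear)
  then have "(scale a y + scale b z) - (scale a y + scale (b * c) z) = 0" using eq by simp
  then have "scale (b * (1 - c)) z = 0" by (simp add: algebra_simps)
  then show "b = 0" using assms by simp
  then show "a = 0" using eq assms by simp
qed

section \<open>Non-commuting atoms: the almost abelian case\<close>

context
  fixes t y :: 'v
  assumes usm: "upper_semimodular" and t: "pmap t = t" and ty: "bracket t y = y" "y \<noteq> 0"
    and py: "pmap y = 0" and pty: "pmap (t + y) = t + y"
begin

lemma atom_t: "atom t"
  by (rule atom_fixed[of _ 1]) (use t ty in auto)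

lemma atom_y: "atom y"
  by (rule atom_fixed[of _ 0]) (use py ty in auto)

text \<open>An atom \<open>b\<close> commuting with \<open>t\<close> can be corrected by a multiple of \<open>t\<close> so that it commutes with
  \<open>y\<close> too; a combination \<open>c\<close> of it with \<open>y\<close> or \<open>t + y\<close> is then an atom with \<open>[t, c] = y\<close>.\<close>

lemma centralizing_atom:
  assumes b: "atom b" "bracket t b = 0"
  shows "b \<in> span {t}"
proof (rule ccontr)
  assume nb: "b \<notin> span {t}"
  obtain \<alpha> \<beta> where yb: "bracket y b = scale \<alpha> y + scale \<beta> b"
    using bracket_atoms(1)[OF usm atom_y b(1)] by (auto simp: span_pair)
  have "bracket t (bracket y b) = bracket y b"
    unfolding bracket_derivation[of t y b] using ty b by simp
  then have "scale \<beta> b = 0" unfolding yb by (simp add: bracket_linear ty b)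
  then have yb: "bracket y b = scale \<alpha> y" using yb by simp
  have yt: "bracket y t = - y" using bracket_swap[of y t] ty by simp
  have bt: "bracket b t = 0" using bracket_swap[of b t] b by simp
  define b' where "b' = b + scale \<alpha> t"
  have b'y: "bracket b' y = 0"
    using bracket_swap[of b y] by (simp add: b'_def bracket_linear yb ty)
  have b't: "bracket b' t = 0" by (simp add: b'_def bracket_linear bt)
  have tb': "bracket t b' = 0" using bracket_swap[of t b'] b't by simp
  obtain \<mu> where \<mu>: "pmap b = scale \<mu> b" using b by (auto simp: atom_def span_singleton)
  have pb': "pmap b' = scale \<mu> b + scale (\<alpha> ^ CHAR('k)) t"
    unfolding b'_def by (subst pmap_add_commuting) (simp_all add: bracket_linear bt \<mu> pmap_scale t)
  have "bracket (pmap b') y = 0" using b'y by (rule bracket_pmap_commuting)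
  then have "scale (\<alpha> ^ CHAR('k) - \<mu> * \<alpha>) y = 0"
    using bracket_swap[of b y] by (simp add: pb' bracket_linear yb ty algebra_simps)
  then have "\<alpha> ^ CHAR('k) = \<mu> * \<alpha>" using ty by simp
  then have "pmap b' = scale \<mu> b + scale (\<mu> * \<alpha>) t" using pb' by simp
  also have "\<dots> = scale \<mu> b'" by (simp add: b'_def algebra_simps)
  finally have pb': "pmap b' = scale \<mu> b'" .
  have nb': "scale \<kappa> b' \<notin> span {t}" if "\<kappa> \<noteq> 0" for \<kappa>
  proof
    assume "scale \<kappa> b' \<in> span {t}"
    then have "scale (inverse \<kappa>) (scale \<kappa> b') \<in> span {t}" by (rule span_scale)
    then have "b' \<in> span {t}" using that by simp
    moreover have "scale \<alpha> t \<in> span {t}" by (intro span_scale span_base) simp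
    ultimately have "b' - scale \<alpha> t \<in> span {t}" by (rule span_diff)
    then show False using nb by (simp add: b'_def)
  qed
  \<comment> \<open>The summands commute, so their sum is an atom once the p-map has the same
    eigenvalue on both: 0 on \<open>b'\<close> and \<open>y\<close>, or 1 on \<open>t + y\<close>
    and on \<open>b'\<close> rescaled by a root of \<kappa>^(p-1) = 1/\<mu>.\<close>
  obtain \<kappa> w \<epsilon> where w: "\<kappa> \<noteq> 0" "w = y \<or> w = t + y" "pmap (scale \<kappa> b' + w) = scale \<epsilon> (scale \<kappa> b' + w)"
  proof (cases "\<mu> = 0")
    case True
    have "pmap (b' + y) = 0" using True by (simp add: pmap_add_commuting b'y pb' py)
    then show thesis by (intro that[of 1 y 0]) auto
  next
    case False
    obtain r where r: "CHAR('k) = Suc (Suc r)" by (rule char_Suc_Suc)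
    obtain \<kappa> where \<kappa>: "\<kappa> ^ Suc r = inverse \<mu>" using nth_root_exists[of "Suc r" "inverse \<mu>"] by auto
    have \<kappa>0: "\<kappa> \<noteq> 0" using \<kappa> False by (intro notI) simp
    have "bracket (scale \<kappa> b') (t + y) = 0" by (simp add: bracket_linear b't b'y)
    then have "pmap (scale \<kappa> b' + (t + y)) = scale (\<kappa> * \<kappa> ^ Suc r * \<mu>) b' + (t + y)"
      by (simp add: pmap_add_commuting pty pmap_scale pb' r)
    then have "pmap (scale \<kappa> b' + (t + y)) = scale 1 (scale \<kappa> b' + (t + y))"
      unfolding \<kappa> using False by simp
    then show thesis using \<kappa>0 by (intro that[of \<kappa> "t + y" 1]) auto
  qed
  define c where "c = scale \<kappa> b' + w"
  have tc: "bracket t c = y" using w(2) tb' ty by (auto simp: c_def bracket_linear)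
  have "atom c" using tc ty w(3) by (intro atom_fixed[of c \<epsilon>]) (auto simp: c_def)
  then obtain \<eta> \<gamma> where y_eq: "y = scale \<eta> t + scale \<gamma> c"
    using bracket_atoms(1)[OF usm atom_t, of c] by (auto simp: tc span_pair)
  have "y = bracket t (scale \<eta> t + scale \<gamma> c)" using ty y_eq by simp
  then have "y = scale \<gamma> y" by (simp add: bracket_linear tc)
  then have "scale (1 - \<gamma>) y = 0" by (simp add: algebra_simps)
  then have "\<gamma> = 1" using ty by simp
  then have "scale \<kappa> b' = (y - w) - scale \<eta> t" using y_eq by (simp add: c_def algebra_simps)
  moreover have "(y - w) - scale \<eta> t \<in> span {t}"
    using w(2)
  proof
    assume "w = y"
    then have "(y - w) - scale \<eta> t = scale (- \<eta>) t" by simp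
    also have "\<dots> \<in> span {t}" by (intro span_scale span_base) simp
    finally show ?thesis .
  next
    assume "w = t + y"
    then have "(y - w) - scale \<eta> t = scale (- 1 - \<eta>) t" by (simp add: algebra_simps)
    also have "\<dots> \<in> span {t}" by (intro span_scale span_base) simp
    finally show ?thesis .
  qed
  ultimately show False using nb'[OF w(1)] by simp
qed

text \<open>A p-map eigenvector modulo \<open>t\<close> that commutes with \<open>t\<close> becomes
  exact after adding a multiple \<open>d\<close> of \<open>t\<close>, where \<open>d\<close> solves
  an equation of Artin-Schreier type; this reduces the claim to atoms.\<close>

lemma centralizer_toral:
  assumes x: "bracket t x = 0"
  shows "x \<in> span {t}"
proof (rule ccontr)
  assume nx: "x \<notin> span {t}"
  obtain v \<epsilon> where v: "v \<in> cyclic x" "v \<notin> span {t}" "pmap v - scale \<epsilon> v \<in> span {t}"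
    using pmap_eigenvector_mod[OF atom_restricted[OF atom_t] nx] by blast
  obtain \<mu> where \<mu>: "pmap v - scale \<epsilon> v = scale \<mu> t"
    using v(3) unfolding span_singleton_mem by blast
  have "bracket x t = 0" using x bracket_swap[of x t] by simp
  then have vt: "bracket v t = 0" using v(1) by (rule cyclic_commute)
  obtain d where d: "d ^ CHAR('k) - \<epsilon> * d = - \<mu>" by (rule artin_schreier_solvable[OF char_ge_2])
  then have "d ^ CHAR('k) = \<epsilon> * d - \<mu>" by (simp add: algebra_simps)
  then have "pmap (v + scale d t) = pmap v + scale (\<epsilon> * d - \<mu>) t"
    by (simp add: pmap_add_commuting bracket_linear vt pmap_scale t)
  also have "\<dots> = scale \<epsilon> (v + scale d t)"
    using \<mu> by (simp add: algebra_simps)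
  finally have eq: "pmap (v + scale d t) = scale \<epsilon> (v + scale d t)" .
  have n: "v + scale d t \<notin> span {t}"
  proof
    assume "v + scale d t \<in> span {t}"
    moreover have "scale d t \<in> span {t}" by (intro span_scale span_base) simp
    ultimately have "(v + scale d t) - scale d t \<in> span {t}" by (rule span_diff)
    with v show False by simp
  qed
  then have "v + scale d t \<noteq> 0" using span_zero by metis
  then have "atom (v + scale d t)" using eq by (rule atom_fixed)
  moreover have "bracket t (v + scale d t) = 0"
    using vt bracket_swap[of t v] by (simp add: bracket_linear)
  ultimately show False using centralizing_atom n by blast
qed

text \<open>x^[p] commutes with \<open>t\<close>, hence is a multiple of \<open>t\<close>; it also
  commutes with \<open>x\<close>, which \<open>t\<close> does not unless
  \<open>x = 0\<close>.\<close>

lemma pmap_weight_vector: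
  assumes x: "bracket t x = scale c x" "c \<noteq> 0"
  shows "pmap x = 0"
proof (cases "x = 0")
  case False
  obtain \<mu> where \<mu>: "pmap x = scale \<mu> t"
    using centralizer_toral[OF pmap_weight_vector_commutes[OF x(1)]] by (auto simp: span_singleton)
  have "bracket (pmap x) x = 0" by (intro bracket_pmap_commuting bracket_self)
  then have "scale (\<mu> * c) x = 0" by (simp add: \<mu> bracket_linear x)
  then show ?thesis using False x \<mu> by simp
qed simp

text \<open>[y, z] has weight 1 + c but lies in the span of weights 1 and c, so it vanishes and y +
  z is an atom. Then [t, y + z] lies in the span of \<open>t\<close> and y + z, and applying ad t
  once more gives c^2 = c.\<close>

lemma weight_cases:
  assumes z: "bracket t z = scale c z" "z \<noteq> 0"
  shows "c = 0 \<or> c = 1"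
proof (rule ccontr)
  assume nc: "\<not> (c = 0 \<or> c = 1)"
  note indep = weight_vectors_independent[OF ty(1) z(1) _ ty(2) z(2)]
  have pz: "pmap z = 0" using z nc by (intro pmap_weight_vector) auto
  have "atom z" by (rule atom_fixed[of _ 0]) (use pz z in auto)
  then obtain \<alpha> \<beta> where yz: "bracket y z = scale \<alpha> y + scale \<beta> z"
    using bracket_atoms(1)[OF usm atom_y, of z] by (auto simp: span_pair)
  have "bracket t (bracket y z) = scale (1 + c) (bracket y z)"
    unfolding bracket_derivation[of t y z] by (simp add: ty z bracket_linear algebra_simps)
  then have "scale (\<alpha> * c) y + scale \<beta> z = 0"
    unfolding yz by (simp add: bracket_linear ty z algebra_simps)
  then have "\<alpha> * c = 0" "\<beta> = 0" using indep nc by blast+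
  then have yz: "bracket y z = 0" using yz nc by simp
  have "y + z \<noteq> 0" using indep(1)[of 1 1] nc by auto
  moreover have "pmap (y + z) = scale 0 (y + z)" by (simp add: pmap_add_commuting yz py pz)
  ultimately have "atom (y + z)" by (rule atom_fixed)
  then obtain \<alpha> \<gamma> where "bracket t (y + z) = scale \<alpha> t + scale \<gamma> (y + z)"
    using bracket_atoms(1)[OF usm atom_t, of "y + z"] by (auto simp: span_pair)
  then have "bracket t (bracket t (y + z)) = scale \<gamma> (bracket t (y + z))"
    by (simp add: bracket_linear)
  then have "scale (1 - \<gamma>) y + scale (c * c - \<gamma> * c) z = 0"
    by (simp add: bracket_linear ty z algebra_simps)
  then have "1 - \<gamma> = 0" "c * c - \<gamma> * c = 0" using indep nc by blast+
  then show False using nc by auto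
qed

text \<open>The bracket has weight 2 but lies in a span of weight 1.\<close>

lemma weight_one_abelian:
  assumes "bracket t x = x" "bracket t z = z"
  shows "bracket x z = 0"
proof (cases "x = 0 \<or> z = 0")
  case False
  have "pmap x = 0" "pmap z = 0" using assms by (auto intro: pmap_weight_vector[of _ 1])
  then have "atom x" "atom z" using False by (auto intro: atom_fixed[of _ 0])
  then obtain \<alpha> \<beta> where xz: "bracket x z = scale \<alpha> x + scale \<beta> z"
    using bracket_atoms(1)[OF usm] span_pair by blast
  then have "bracket t (bracket x z) = bracket x z" by (simp add: bracket_linear assms)
  moreover have "bracket t (bracket x z) = bracket x z + bracket x z"
    unfolding bracket_derivation[of t x z] by (simp add: assms)
  ultimately show ?thesis by simp
qed auto

lemma toral_decomposition: "sum_set (span {t}) {z. bracket t z = z} = UNIV" (is "?V = UNIV")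
proof (rule ccontr)
  assume "?V \<noteq> UNIV"
  then obtain x where x: "x \<notin> ?V" by blast
  have subW: "subspace {z. bracket t z = z}" by (rule subspaceI) (auto simp: bracket_linear)
  then have subV: "subspace ?V" by (intro subspace_sum_set) auto
  have memV: "scale \<alpha> t + z \<in> ?V" if "bracket t z = z" for \<alpha> z
    using that by (auto intro!: sum_setI simp: span_singleton)
  obtain v c where v: "v \<notin> ?V" "bracket t v - scale c v \<in> ?V"
    using eigenvector_mod[of "bracket t" UNIV ?V x] subV x
    by (auto simp: bracket_linear)
  then obtain \<alpha> z where z: "bracket t v - scale c v = scale \<alpha> t + z" "bracket t z = z"
    by (auto simp: sum_set_def span_singleton)
  have nv: "v + w \<notin> ?V" if "w \<in> ?V" for w
    using v(1) subspace_diff[OF subV, of "v + w" w] that by auto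
  have tv: "bracket t v = scale c v + scale \<alpha> t + z" using z(1) by (simp add: algebra_simps)
  consider "c \<noteq> 0" "c \<noteq> 1" | "c = 0" | "c = 1" by blast
  then show False
  proof cases
    case 1
    \<comment> \<open>\<open>c\<close> differs from the weights 0 and 1 of the two error terms, so
      both can be solved away.\<close>
    define w where "w = scale (\<alpha> / c) t + scale (inverse (c - 1)) z"
    have wV: "w \<in> ?V" unfolding w_def by (intro memV) (simp add: bracket_linear z)
    have "scale (1 + inverse (c - 1)) z = scale (c * inverse (c - 1)) z"
      using 1 by (intro arg_cong[where f = "\<lambda>c. scale c z"]) (simp add: field_simps)
    then have "bracket t (v + w) = scale c (v + w)"
      using 1 by (simp add: w_def bracket_linear tv z algebra_simps)
    moreover have "v + w \<noteq> 0" using nv[OF wV] subspace_0[OF subV] by metis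
    ultimately show False using weight_cases 1 by blast
  next
    case 2
    have "bracket t (bracket t (v - z)) = 0" using 2 by (simp add: bracket_linear tv z)
    then have "bracket t (v - z) = 0" by (rule toral_square_zero[OF t])
    then have "v - z \<in> span {t}" by (rule centralizer_toral)
    then obtain \<beta> where "v - z = scale \<beta> t" by (auto simp: span_singleton)
    then have "v = scale \<beta> t + z" by (simp add: algebra_simps)
    then show False using v(1) memV[OF z(2)] by metis
  next
    case 3
    define w where "w = v + scale \<alpha> t"
    have tw: "bracket t w = w + z" using 3 by (simp add: w_def bracket_linear tv algebra_simps)
    \<comment> \<open>After p iterations the error \<open>z\<close> carries the factor p = 0, and
      \<open>pmap t = t\<close> makes \<open>w\<close> an exact eigenvector.\<close>
    have "(bracket t ^^ n) w = w + scale (of_nat n) z" for n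
      by (induction n) (simp_all add: bracket_linear tw z algebra_simps)
    from this[of "CHAR('k)"] have "bracket (pmap t) w = w" by (simp add: ad_pmap)
    then have "bracket t w = w" by (simp add: t)
    then have "scale (- \<alpha>) t + w \<in> ?V" by (rule memV)
    then show False using v(1) by (simp add: w_def)
  qed
qed

lemma almost_abelian_of_toral_pair: "almost_abelian"
proof -
  let ?A = "{z. bracket t z = z}"
  have sub: "subspace ?A" by (rule subspaceI) (auto simp: bracket_linear)
  have "lie_ideal ?A"
    unfolding lie_ideal_def
  proof (intro conjI allI ballI sub)
    fix x a assume a: "a \<in> ?A"
    have "x \<in> sum_set (span {t}) ?A" using toral_decomposition by simp
    then obtain c z where "x = scale c t + z" "z \<in> ?A" by (auto simp: sum_set_def span_singleton)
    then have "bracket x a = scale c a" using a weight_one_abelian[of z a] by (simp add: bracket_linear)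
    then show "bracket x a \<in> ?A" using subspace_scale[OF sub a] by simp
  qed
  moreover have "span {t} \<inter> ?A = {0}" by (auto simp: span_singleton_mem bracket_linear intro: exI[of _ 0])
  ultimately show ?thesis
    unfolding almost_abelian_def using weight_one_abelian toral_decomposition[unfolded sum_set_def]
    by (intro exI[of _ t] exI[of _ ?A] conjI) auto
qed

end

text \<open>For s = c x + a and t = d x + b one computes [s, t] = c t - d s.\<close>

lemma almost_abelian_quasi:
  assumes "almost_abelian" and S: "restricted_subalgebra S" and T: "restricted_subalgebra T"
    and s: "s \<in> S" and t: "t \<in> T"
  shows "bracket s t \<in> sum_set S T"
proof -
  obtain x A where A: "\<forall>a\<in>A. \<forall>b\<in>A. bracket a b = 0" "\<forall>a\<in>A. bracket x a = a"
    "{u + a | u a. u \<in> span {x} \<and> a \<in> A} = UNIV"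
    using assms(1) unfolding almost_abelian_def by blast
  have "\<exists>c a. v = scale c x + a \<and> a \<in> A" for v
  proof -
    have "v \<in> {u + a | u a. u \<in> span {x} \<and> a \<in> A}" using A(3) by simp
    then show ?thesis by (auto simp: span_singleton)
  qed
  then obtain c a d b where ab: "s = scale c x + a" "a \<in> A" "t = scale d x + b" "b \<in> A" by metis
  have "bracket a x = - a" using A(2) ab bracket_swap[of a x] by simp
  then have "bracket s t = scale (- d) s + scale c t"
    using A ab by (simp add: bracket_linear algebra_simps)
  also have "\<dots> \<in> sum_set S T"
    using s t restricted_subalgebraD(6)[OF S] restricted_subalgebraD(6)[OF T] by (intro sum_setI)
  finally show ?thesis .
qed

section \<open>Commuting atoms: toral elements are central\<close>

context
  assumes atoms_commute: "\<And>a b. atom a \<Longrightarrow> atom b \<Longrightarrow> bracket a b = 0"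
begin

text \<open>If \<open>x\<close> is a weight vector of \<open>t\<close>, then some toral element of the cyclic subalgebra of
  \<open>t + x\<close> acts nontrivially on \<open>x\<close>; it cannot commute with both \<open>t\<close> and \<open>t + x\<close>.\<close>

lemma toral_weight_zero:
  assumes t: "pmap t = t" and x: "bracket t x = scale c x" "x \<noteq> 0"
  shows "c = 0"
proof (rule ccontr)
  assume c: "c \<noteq> 0"
  then have "t \<noteq> 0" using x by auto
  then have at: "atom t" by (rule atom_fixed[of _ 1]) (simp add: t)
  have "bracket (pmap x) t = 0"
    using pmap_weight_vector_commutes[OF x(1)] bracket_swap[of "pmap x" t] by simp
  note Zt = cyclic_commute[OF this]
  have Zx: "bracket z x = 0" if "z \<in> cyclic (pmap x)" for z
    using subsetD[OF cyclic_pmap_subset that] cyclic_self by (rule cyclic_abelian)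
  let ?R = "sum_set (span {t}) (cyclic x)"
  have R: "restricted_subalgebra ?R"
  proof (rule restricted_subalgebra_sum)
    fix s h assume "s \<in> span {t}" and h: "h \<in> cyclic x"
    then obtain \<alpha> where s: "s = scale \<alpha> t" by (auto simp: span_singleton)
    obtain d z where dz: "h = scale d x + z" "z \<in> cyclic (pmap x)" using h by (rule cyclic_memE)
    have "bracket s h = scale (\<alpha> * d * c) x"
      using Zt[OF dz(2)] bracket_swap[of t z] by (simp add: s dz bracket_linear x)
    also have "\<dots> \<in> cyclic x" by (intro restricted_subalgebraD(6) cyclic_restricted cyclic_self)
    finally show "bracket s h \<in> ?R"
      using sum_set_upper(2)[of "span {t}" "cyclic x"] restricted_subalgebraD(1)[OF cyclic_restricted] by auto
  qed (use at in \<open>auto intro: atom_restricted cyclic_restricted\<close>)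
  define u where "u = t + x"
  have "u \<in> ?R" unfolding u_def by (intro sum_setI cyclic_self) (auto intro: span_base)
  then have uR: "cyclic u \<subseteq> ?R" using R by (rule cyclic_least)
  have ux: "bracket u x = scale c x" by (simp add: u_def bracket_linear x)
  interpret semilinear_map scale Basis pmap "cyclic u" by (rule semilinear_cyclic)
  \<comment> \<open>Since [u, x] = c x, each such p-power of \<open>u\<close> scales
    \<open>x\<close> by a nonzero factor; for this \<open>k\<close> it is a combination of toral
    elements, one of which must move \<open>x\<close>.\<close>
  obtain k where k: "(pmap ^^ k) u \<in> fixed_span"
    using funpow_in_fixed_span[OF cyclic_self] by blast
  have "\<exists>s\<in>cyclic u. pmap s = s \<and> bracket s x \<noteq> 0"
  proof (rule ccontr)
    assume "\<not> ?thesis"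
    then have "{s \<in> cyclic u. pmap s = s} \<subseteq> {s. bracket x s = 0}" using bracket_swap[of x] by auto
    then have "fixed_span \<subseteq> {s. bracket x s = 0}"
      unfolding fixed_span_def by (intro span_minimal subspace_centralizer)
    then have "bracket ((pmap ^^ k) u) x = 0" using k bracket_swap[of "(pmap ^^ k) u" x] by auto
    then have "scale (c ^ (CHAR('k) ^ k)) x = 0"
      unfolding bracket_funpow_pmap funpow_bracket_eigenvector[OF ux] .
    then show False using c x by simp
  qed
  then obtain s where s: "s \<in> cyclic u" "pmap s = s" "bracket s x \<noteq> 0" by blast
  then have "s \<in> ?R" using uR by blast
  then obtain \<alpha> h where "s = scale \<alpha> t + h" "h \<in> cyclic x"
    by (auto simp: sum_set_def span_singleton)
  then obtain \<beta> z where sz: "s = scale \<alpha> t + (scale \<beta> x + z)" "z \<in> cyclic (pmap x)"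
    by (metis cyclic_memE)
  have sx: "bracket s x = scale (\<alpha> * c) x" by (simp add: sz bracket_linear x Zx)
  have "atom s" using s by (intro atom_fixed[of _ 1]) auto
  \<comment> \<open>Commuting with \<open>t\<close> removes the \<open>x\<close>-coefficient of
    \<open>s\<close>; then [s, u] = [s, x] is nonzero, although \<open>s\<close> and
    \<open>u\<close> lie in the abelian \<open>cyclic u\<close>.\<close>
  then have "bracket t s = 0" using atoms_commute at by blast
  then have "scale (\<beta> * c) x = 0"
    using Zt[OF sz(2)] bracket_swap[of t z] by (simp add: sz bracket_linear x)
  then have "\<beta> = 0" using c x by simp
  have "bracket s u = 0" using s cyclic_self by (intro cyclic_abelian[of s u])
  moreover have "bracket s u = scale (\<alpha> * c) x"
    by (simp add: u_def sz \<open>\<beta> = 0\<close> bracket_linear x Zt Zx)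
  ultimately show False using s(3) sx by simp
qed

text \<open>If ad t were nonzero, it would have an eigenvector in its own range; the weight is 0, so
  the square of ad t kills a preimage, and so does ad t.\<close>

lemma toral_central:
  assumes t: "pmap t = t"
  shows "bracket t z = 0"
proof (rule ccontr)
  assume nz: "bracket t z \<noteq> 0"
  have sub: "subspace (range (bracket t))"
    by (rule subspaceI)
      (auto simp flip: bracket_add_right bracket_scale_right intro: range_eqI[of _ _ 0])
  obtain v c where v: "v \<in> range (bracket t)" "v \<notin> {0}" "bracket t v - scale c v \<in> {0}"
    by (rule eigenvector_mod[of "bracket t" "range (bracket t)" "{0}" "bracket t z"])
      (use sub nz in \<open>auto simp: bracket_linear\<close>)
  then have "c = 0" using toral_weight_zero[OF t, of v c] by simp
  then have "bracket t v = 0" using v by simp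
  with v toral_square_zero[OF t] show False by auto
qed

lemma atoms_commute_imp_ad_nilpotent: "ad_nilpotent"
  unfolding ad_nilpotent_def
proof
  fix x
  interpret semilinear_map scale Basis pmap "cyclic x" by (rule semilinear_cyclic)
  obtain k where k: "(pmap ^^ k) x \<in> fixed_span"
    using funpow_in_fixed_span[OF cyclic_self] by blast
  have "bracket ((pmap ^^ k) x) y = 0" for y
  proof -
    have "fixed_span \<subseteq> {s. bracket y s = 0}"
      unfolding fixed_span_def using toral_central bracket_swap[of y]
      by (intro span_minimal subspace_centralizer) auto
    then show ?thesis using k bracket_swap[of "(pmap ^^ k) x" y] by auto
  qed
  then show "\<exists>n. \<forall>y. (bracket x ^^ n) y = 0" unfolding bracket_funpow_pmap by blast
qed

end

section \<open>Combination of the two cases\<close>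

lemma upper_semimodular_cases:
  assumes usm: "upper_semimodular"
  shows "(\<forall>S. restricted_subalgebra S \<longrightarrow> restricted_quasi_ideal S) \<and>
    (almost_abelian \<or> nilpotent_class_le 2)"
proof (cases "\<exists>a b. atom a \<and> atom b \<and> bracket a b \<noteq> 0")
  case True
  then obtain t y where "pmap t = t" "bracket t y = y" "y \<noteq> 0" "pmap y = 0" "pmap (t + y) = t + y"
    using toral_pair_of_atoms[OF usm] by blast
  then have "almost_abelian" by (rule almost_abelian_of_toral_pair[OF usm])
  then show ?thesis unfolding quasi_ideals_iff using almost_abelian_quasi by blast
next
  case False
  then have nil: "ad_nilpotent" by (intro atoms_commute_imp_ad_nilpotent) blast
  have quasi: "bracket s t \<in> sum_set S T"
    if "restricted_subalgebra S" "restricted_subalgebra T" "s \<in> S" "t \<in> T" for S T s t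
  proof -
    have "s \<in> generated (S \<union> T)" "t \<in> generated (S \<union> T)"
      using that generated_superset[of "S \<union> T"] by blast+
    then have "bracket s t \<in> generated (S \<union> T)"
      by (intro restricted_subalgebraD(2) restricted_subalgebra_generated)
    then show ?thesis using ad_nilpotent_join_eq_sum[OF nil usm that(1,2)] by simp
  qed
  moreover have "nilpotent_class_le 2" using nil quasi by (rule nilpotent_class_2)
  ultimately show ?thesis unfolding quasi_ideals_iff by blast
qed

lemma quasi_ideals_imp_modular:
  assumes "\<forall>S. restricted_subalgebra S \<longrightarrow> restricted_quasi_ideal S"
  shows "modular"
  using assms unfolding quasi_ideals_iff
  by (intro modular_if_joins_are_sums generated_Un_sum) blast+

theorem upper_semimodular_characterization:
  "(upper_semimodular \<longleftrightarrow> modular) \<and>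
   (modular \<longleftrightarrow> (\<forall>S. restricted_subalgebra S \<longrightarrow> restricted_quasi_ideal S)) \<and>
   (upper_semimodular \<or> modular \<or> (\<forall>S. restricted_subalgebra S \<longrightarrow> restricted_quasi_ideal S) \<longrightarrow>
    almost_abelian \<or> nilpotent_class_le 2)"
  using upper_semimodular_cases quasi_ideals_imp_modular modular_imp_upper_semimodular by blast

end

theorem theorem6p1:
  fixes scale :: "'k::alg_closed_field \<Rightarrow> 'v::ab_group_add \<Rightarrow> 'v"
    and bracket :: "'v \<Rightarrow> 'v \<Rightarrow> 'v"
    and pmap :: "'v \<Rightarrow> 'v"
  assumes "restricted_lie_algebra scale bracket pmap"
    and "\<exists>Basis. finite_dimensional_vector_space scale Basis"
  shows "(restricted_lie_algebra.upper_semimodular scale bracket pmap \<longleftrightarrow>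
            restricted_lie_algebra.modular scale bracket pmap) \<and>
         (restricted_lie_algebra.modular scale bracket pmap \<longleftrightarrow>
            (\<forall>S. restricted_lie_algebra.restricted_subalgebra scale bracket pmap S \<longrightarrow>
                 restricted_lie_algebra.restricted_quasi_ideal scale bracket pmap S)) \<and>
         (restricted_lie_algebra.upper_semimodular scale bracket pmap \<or>
          restricted_lie_algebra.modular scale bracket pmap \<or>
          (\<forall>S. restricted_lie_algebra.restricted_subalgebra scale bracket pmap S \<longrightarrow>
               restricted_lie_algebra.restricted_quasi_ideal scale bracket pmap S) \<longrightarrow>
          lie_algebra.almost_abelian scale bracket \<or> lie_algebra.nilpotent_class_le scale bracket 2)"
proof -
  obtain Basis where "finite_dimensional_vector_space scale Basis" using assms(2) by blast
  with assms(1) interpret fd_restricted_lie_algebra scale bracket pmap Basis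
    by (simp add: fd_restricted_lie_algebra_def alg_closed_vector_space_def)
  show ?thesis by (rule upper_semimodular_characterization)
qed

end
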